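(* Let $G$ be a group, $Y\subseteq G$ a finite set containing at least two elements which generates $G$ as a semigroup, $F:Y\to\mathbb R$ a function, and $\beta\in\mathbb R$. Assume that the abelianization $G/[G,G]$ is trivial or a finite group. Then there is an abelian $\beta$-KMS measure for $\alpha^F$ on $Y^{\mathbb N}$ if and only if $$\sum_{s\in Y}e^{-\beta F(s)}=1.$$ When it exists, the abelian $\beta$-KMS measure is unique and it is the Bernoulli measure corresponding to the probability vector $p(s)=e^{-\beta F(s)}$, $s\in Y$.
   Context: Words: $Y^0=\{\emptyset\}$; for $t=(t_1,\dots,t_k)\in Y^k$ put $\overline t=t_1t_2\cdots t_k\in G$ and $F(t)=\sum_{j=1}^k F(t_j)$; $\overline{\emptyset}=e_0$ (the neutral element of $G$), $F(\emptyset)=0$. $tY^{\mathbb N}\subseteq Y^{\mathbb N}$ is the cylinder set of infinite words starting with $t$, and $\emptyset Y^{\mathbb N}=Y^{\mathbb N}$. $O_Y$ is the Cuntz algebra generated by isometries $V_s$, $s\in Y$, with $\sum_{s\in Y}V_sV_s^*=1$; $V_t=V_{t_1}\cdots V_{t_k}$, $V_\emptyset=1$. $O_Y(G)\subseteq O_Y$ is the $C^*$-subalgebra which is the closed linear span of the elements $V_tV_u^*$ with $\overline t=\overline u$. $\alpha^F$ is the one-parameter group of automorphisms of $O_Y$ (restricted to $O_Y(G)$) with $\alpha^F_r(V_wV_u^* )=e^{ir(F(w)-F(u))}V_wV_u^*$, $r\in\mathbb R$. A state $\omega$ on $O_Y(G)$ is a $\beta$-KMS state for $\alpha^F$ if there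 is a dense $\alpha^F$-invariant $*$-subalgebra $\mathcal A$ of $O_Y(G)$ consisting of analytic elements for $\alpha^F$ with $\omega(ab)=\omega(b\,\alpha^F_{i\beta}(a))$ for all $a,b\in\mathcal A$. The elements $V_tV_t^*$ generate a copy of $C(Y^{\mathbb N})$ in $O_Y(G)$ ($V_tV_t^*$ being the indicator function of $tY^{\mathbb N}$), and $E:O_Y\to C(Y^{\mathbb N})$ is the conditional expectation with $E(V_tV_u^* )=V_tV_t^*$ if $t=u$ and $0$ otherwise. A Borel probability measure $m$ on $Y^{\mathbb N}$ is a $\beta$-KMS measure for $\alpha^F$ when the state $a\mapsto\int_{Y^{\mathbb N}}E(a)\,\mathrm dm$ on $O_Y(G)$ is a $\beta$-KMS state for $\alpha^F$. A Borel measure $m$ on $Y^{\mathbb N}$ is abelian when $m(t_1t_2t_3Y^{\mathbb N})=m(t_1t_3t_2Y^{\mathbb N})$ for all words $t_1,t_2,t_3\in\bigcup_kY^k$ (concatenation). The Bernoulli measure corresponding to a map $p:Y\to[0,1]$ with $\sum_yp(y)=1$ is the infinite product measure, $m(tY^{\mathbb N})=\prod_{i=1}^kp(t_i)$ for $t\in Y^k$. *)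

theory Defs
  imports "HOL-Analysis.Analysis" "HOL-Probability.Probability" "HOL-Algebra.Generated_Groups"
begin

section \<open>Unital C*-algebras\<close>

text \<open>The class \<^class>\<open>real_normed_algebra_1\<close> contributes \<open>norm 1 = 1\<close> and submultiplicativity
  of the norm.\<close>

class cstar_algebra = banach + real_normed_algebra_1 +
  fixes scaleC :: "complex \<Rightarrow> 'a \<Rightarrow> 'a"  (infixr \<open>*\<^sub>C\<close> 75)
    and star :: "'a \<Rightarrow> 'a"
  assumes scaleC_add_right: "c *\<^sub>C (x + y) = c *\<^sub>C x + c *\<^sub>C y"
    and scaleC_add_left: "(c + d) *\<^sub>C x = c *\<^sub>C x + d *\<^sub>C x"
    and scaleC_scaleC: "c *\<^sub>C (d *\<^sub>C x) = (c * d) *\<^sub>C x"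
    and scaleC_of_real: "complex_of_real r *\<^sub>C x = r *\<^sub>R x"
    and scaleC_mult_left: "(c *\<^sub>C x) * y = c *\<^sub>C (x * y)"
    and scaleC_mult_right: "x * (c *\<^sub>C y) = c *\<^sub>C (x * y)"
    and norm_scaleC: "norm (c *\<^sub>C x) = cmod c * norm x"
    and star_star: "star (star x) = x"
    and star_add: "star (x + y) = star x + star y"
    and star_mult: "star (x * y) = star y * star x"
    and star_scaleC: "star (c *\<^sub>C x) = cnj c *\<^sub>C star x"
    and cstar_identity: "norm (star x * x) = (norm x)\<^sup>2"

definition csubspace :: "'a::cstar_algebra set \<Rightarrow> bool" where
  "csubspace S \<longleftrightarrow> 0 \<in> S \<and> (\<forall>x\<in>S. \<forall>y\<in>S. x + y \<in> S) \<and> (\<forall>c. \<forall>x\<in>S. c *\<^sub>C x \<in> S)"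

definition closed_cspan :: "'a::cstar_algebra set \<Rightarrow> 'a set" where
  "closed_cspan X = closure (csubspace hull X)"

definition star_subalgebra :: "'a::cstar_algebra set \<Rightarrow> bool" where
  "star_subalgebra S \<longleftrightarrow>
     csubspace S \<and> (\<forall>x\<in>S. \<forall>y\<in>S. x * y \<in> S) \<and> (\<forall>x\<in>S. star x \<in> S)"

definition cstar_generated :: "'a::cstar_algebra set \<Rightarrow> 'a set" where
  "cstar_generated X = (\<lambda>S. star_subalgebra S \<and> closed S) hull X"

definition cstar_positive :: "'a::cstar_algebra \<Rightarrow> bool" where
  "cstar_positive x \<longleftrightarrow> (\<exists>b. x = star b * b)"

definition clinear_op :: "('a::cstar_algebra \<Rightarrow> 'a) \<Rightarrow> bool" where
  "clinear_op f \<longleftrightarrow> (\<forall>x y. f (x + y) = f x + f y) \<and> (\<forall>c x. f (c *\<^sub>C x) = c *\<^sub>C f x)"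

definition star_automorphism :: "('a::cstar_algebra \<Rightarrow> 'a) \<Rightarrow> bool" where
  "star_automorphism f \<longleftrightarrow>
     bij f \<and> clinear_op f \<and> (\<forall>x y. f (x * y) = f x * f y) \<and> (\<forall>x. f (star x) = star (f x))"

definition conditional_expectation :: "'a::cstar_algebra set \<Rightarrow> ('a \<Rightarrow> 'a) \<Rightarrow> bool" where
  "conditional_expectation D E \<longleftrightarrow>
     clinear_op E \<and> (\<forall>a. E a \<in> D) \<and> (\<forall>d\<in>D. E d = d) \<and>
     (\<forall>a. norm (E a) \<le> norm a) \<and>
     (\<forall>a. cstar_positive a \<longrightarrow> cstar_positive (E a)) \<and>
     (\<forall>d\<in>D. \<forall>d'\<in>D. \<forall>a. E (d * a * d') = d * E a * d')"


section \<open>States, one-parameter groups and KMS states\<close>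

text \<open>In this section \<open>B\<close> is a unital C*-subalgebra of the ambient C*-algebra; only the values of
  \<open>\<omega>\<close> on \<open>B\<close> matter.\<close>

definition state_on :: "'a::cstar_algebra set \<Rightarrow> ('a \<Rightarrow> complex) \<Rightarrow> bool" where
  "state_on B \<omega> \<longleftrightarrow>
     (\<forall>x\<in>B. \<forall>y\<in>B. \<omega> (x + y) = \<omega> x + \<omega> y) \<and>
     (\<forall>c. \<forall>x\<in>B. \<omega> (c *\<^sub>C x) = c * \<omega> x) \<and>
     (\<forall>x\<in>B. \<omega> (star x * x) \<in> \<real>\<^sub>\<ge>\<^sub>0) \<and>
     \<omega> 1 = 1"

definition one_parameter_group :: "(real \<Rightarrow> 'a::cstar_algebra \<Rightarrow> 'a) \<Rightarrow> bool" where
  "one_parameter_group \<alpha> \<longleftrightarrow>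
     (\<forall>r. star_automorphism (\<alpha> r)) \<and> \<alpha> 0 = id \<and> (\<forall>r s. \<alpha> (r + s) = \<alpha> r \<circ> \<alpha> s) \<and>
     (\<forall>a. continuous_on UNIV (\<lambda>r. \<alpha> r a))"

definition entire :: "(complex \<Rightarrow> 'a::cstar_algebra) \<Rightarrow> bool" where
  "entire f \<longleftrightarrow> (\<forall>z. \<exists>d. ((\<lambda>h. inverse h *\<^sub>C (f (z + h) - f z)) \<longlongrightarrow> d) (at 0))"

text \<open>An element \<open>a\<close> of \<open>B\<close> is analytic for \<open>\<alpha>\<close> when \<open>r \<mapsto> \<alpha> r a\<close> extends to an entire function
  \<open>f\<close> with values in \<open>B\<close>. By the identity theorem \<open>f\<close> is then unique, and \<open>f z\<close> is the element
  usually written \<open>\<alpha>\<^sub>z(a)\<close>.\<close>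

definition analytic_extension ::
  "'a::cstar_algebra set \<Rightarrow> (real \<Rightarrow> 'a \<Rightarrow> 'a) \<Rightarrow> 'a \<Rightarrow> (complex \<Rightarrow> 'a) \<Rightarrow> bool" where
  "analytic_extension B \<alpha> a f \<longleftrightarrow>
     entire f \<and> range f \<subseteq> B \<and> (\<forall>r. f (complex_of_real r) = \<alpha> r a)"

definition KMS_state ::
  "'a::cstar_algebra set \<Rightarrow> (real \<Rightarrow> 'a \<Rightarrow> 'a) \<Rightarrow> real \<Rightarrow> ('a \<Rightarrow> complex) \<Rightarrow> bool" where
  "KMS_state B \<alpha> \<beta> \<omega> \<longleftrightarrow>
     state_on B \<omega> \<and>
     (\<exists>A. star_subalgebra A \<and> A \<subseteq> B \<and> B \<subseteq> closure A \<and> (\<forall>r. \<alpha> r ` A \<subseteq> A) \<and>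
        (\<forall>a\<in>A. \<exists>f. analytic_extension B \<alpha> a f \<and>
           (\<forall>b\<in>A. \<omega> (a * b) = \<omega> (b * f (\<i> * complex_of_real \<beta>)))))"


section \<open>Words, infinite words and measures\<close>

text \<open>Finite words over \<open>Y\<close> are the elements of \<open>lists Y\<close>; the infinite words \<open>Y\<^sup>\<nat>\<close> are the
  functions \<open>nat \<Rightarrow> 'g\<close> with values in \<open>Y\<close>.\<close>

definition word_eval :: "('g, 'm) monoid_scheme \<Rightarrow> 'g list \<Rightarrow> 'g" where
  "word_eval G t = foldr (mult G) t (one G)"

definition generates_as_semigroup :: "('g, 'm) monoid_scheme \<Rightarrow> 'g set \<Rightarrow> bool" where
  "generates_as_semigroup G Y \<longleftrightarrow> carrier G = word_eval G ` (lists Y - {[]})"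

definition word_weight :: "('g \<Rightarrow> real) \<Rightarrow> 'g list \<Rightarrow> real" where
  "word_weight F t = sum_list (map F t)"

definition path_topology :: "'g set \<Rightarrow> (nat \<Rightarrow> 'g) topology" where
  "path_topology Y = product_topology (\<lambda>_. discrete_topology Y) UNIV"

definition paths :: "'g set \<Rightarrow> (nat \<Rightarrow> 'g) set" where
  "paths Y = topspace (path_topology Y)"

definition path_borel :: "'g set \<Rightarrow> (nat \<Rightarrow> 'g) measure" where
  "path_borel Y = sigma (paths Y) {U. openin (path_topology Y) U}"

definition cylinder :: "'g set \<Rightarrow> 'g list \<Rightarrow> (nat \<Rightarrow> 'g) set" where
  "cylinder Y t = {x \<in> paths Y. \<forall>i<length t. x i = t ! i}"

definition borel_prob_on_paths :: "'g set \<Rightarrow> (nat \<Rightarrow> 'g) measure \<Rightarrow> bool" where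
  "borel_prob_on_paths Y m \<longleftrightarrow> prob_space m \<and> sets m = sets (path_borel Y)"

definition abelian_measure :: "'g set \<Rightarrow> (nat \<Rightarrow> 'g) measure \<Rightarrow> bool" where
  "abelian_measure Y m \<longleftrightarrow>
     (\<forall>t1\<in>lists Y. \<forall>t2\<in>lists Y. \<forall>t3\<in>lists Y.
        emeasure m (cylinder Y (t1 @ t2 @ t3)) = emeasure m (cylinder Y (t1 @ t3 @ t2)))"

definition bernoulli_measure :: "'g set \<Rightarrow> ('g \<Rightarrow> real) \<Rightarrow> (nat \<Rightarrow> 'g) measure" where
  "bernoulli_measure Y p = (\<Pi>\<^sub>M i\<in>UNIV. point_measure Y (\<lambda>y. ennreal (p y)))"

lemma paths_eq: "paths Y = (\<Pi>\<^sub>E i\<in>UNIV. Y)"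
  by (simp add: paths_def path_topology_def)

text \<open>The Borel and the product \<open>\<sigma>\<close>-algebra on \<open>Y\<^sup>\<nat>\<close> agree, so that \<^const>\<open>bernoulli_measure\<close> is a
  Borel measure on \<open>Y\<^sup>\<nat>\<close>, with the expected values on cylinders.\<close>

lemma sets_path_borel:
  assumes "finite Y"
  shows "sets (path_borel Y) = sets (\<Pi>\<^sub>M i\<in>(UNIV::nat set). count_space Y)"
proof -
  let ?P = "\<Pi>\<^sub>M i\<in>(UNIV::nat set). count_space Y"
  let ?T = "path_topology Y"
  have sub: "{U. openin ?T U} \<subseteq> Pow (paths Y)"
    by (auto simp: paths_def dest: openin_subset)
  have sb: "sets (path_borel Y) = sigma_sets (paths Y) {U. openin ?T U}"
    unfolding path_borel_def using sub by (rule sets_measure_of)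
  have spP: "space ?P = paths Y" by (simp add: space_PiM paths_eq)
  have cyl: "cylinder Y t \<in> sets ?P" if "t \<in> lists Y" for t
  proof -
    have "cylinder Y t = {x \<in> space ?P. \<forall>i\<in>{..<length t}. x i = t ! i}"
      by (auto simp: cylinder_def spP)
    also have "\<dots> \<in> sets ?P"
    proof (rule sets.sets_Collect_finite_All)
      show "{x \<in> space ?P. x i = t ! i} \<in> sets ?P" if "i \<in> {..<length t}" for i
      proof -
        have "t ! i \<in> Y" using that \<open>t \<in> lists Y\<close> by auto
        then have "(\<lambda>x. x i) -` {t ! i} \<inter> space ?P \<in> sets ?P"
          by (intro measurable_sets[where A="count_space Y"] measurable_component_singleton) auto
        then show ?thesis by (simp add: vimage_def Int_def conj_commute)
      qed
    qed (use that in auto)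
    finally show ?thesis .
  qed
  have "U \<in> sets ?P" if U: "openin ?T U" for U
  proof -
    define C where "C = {t \<in> lists Y. cylinder Y t \<subseteq> U}"
    have "U \<subseteq> (\<Union>t\<in>C. cylinder Y t)"
    proof
      fix x assume x: "x \<in> U"
      then obtain W where W: "finite {i. W i \<noteq> Y}" "x \<in> Pi\<^sub>E UNIV W" "Pi\<^sub>E UNIV W \<subseteq> U"
        and Wo: "\<And>i. W i \<subseteq> Y"
        using U unfolding path_topology_def openin_product_topology_alt by auto
      obtain n where n: "\<And>i. W i \<noteq> Y \<Longrightarrow> i < n"
        using W(1) finite_nat_set_iff_bounded by auto
      have xY: "x \<in> paths Y" using W(2) Wo by (auto simp: paths_eq PiE_iff)
      let ?t = "map x [0..<n]"
      have "?t \<in> lists Y" using xY by (auto simp: paths_eq PiE_iff)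
      moreover have "cylinder Y ?t \<subseteq> Pi\<^sub>E UNIV W"
      proof
        fix y assume y: "y \<in> cylinder Y ?t"
        have "y i \<in> W i" for i
        proof (cases "W i = Y")
          case True then show ?thesis using y by (auto simp: cylinder_def paths_eq PiE_iff)
        next
          case False then show ?thesis using y n[OF False] W(2) by (auto simp: cylinder_def PiE_iff)
        qed
        then show "y \<in> Pi\<^sub>E UNIV W" by auto
      qed
      moreover have "x \<in> cylinder Y ?t" using xY by (auto simp: cylinder_def)
      ultimately have "?t \<in> C" and "x \<in> cylinder Y ?t" using W(3) by (simp_all add: C_def)
      then show "x \<in> (\<Union>t\<in>C. cylinder Y t)" by (rule UN_I)
    qed
    then have eq: "U = (\<Union>t\<in>C. cylinder Y t)" by (auto simp: C_def)
    have "countable C"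
      using countable_lists[OF countable_finite[OF assms]] by (auto simp: C_def intro: countable_subset)
    then show ?thesis
      unfolding eq by (rule sets.countable_UN') (use cyl in \<open>auto simp: C_def\<close>)
  qed
  then have "sigma_sets (paths Y) {U. openin ?T U} \<subseteq> sets ?P"
    unfolding spP[symmetric] by (intro sets.sigma_sets_subset) auto
  moreover have "{f \<in> paths Y. f i \<in> A} \<in> {U. openin ?T U}" if "A \<subseteq> Y" for i A
    using openin_continuous_map_preimage
        [OF continuous_map_product_projection[of i UNIV "\<lambda>_. discrete_topology Y"], of A] that
    by (simp add: path_topology_def paths_def)
  then have "sets ?P \<subseteq> sigma_sets (paths Y) {U. openin ?T U}"
    unfolding sets_PiM_single space_count_space paths_eq[symmetric] sets_count_space
    by (intro sigma_sets_mono') blast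
  ultimately show ?thesis unfolding sb by blast
qed

lemma emeasure_bernoulli_cylinder:
  assumes Y: "finite Y" and p: "\<And>y. y \<in> Y \<Longrightarrow> 0 \<le> p y" "(\<Sum>y\<in>Y. p y) = 1" and t: "t \<in> lists Y"
  shows "emeasure (bernoulli_measure Y p) (cylinder Y t) = ennreal (prod_list (map p t))"
proof -
  let ?N = "point_measure Y (\<lambda>y. ennreal (p y))"
  let ?M = "\<lambda>_::nat. ?N"
  have "emeasure ?N (space ?N) = (\<Sum>y\<in>Y. ennreal (p y))"
    unfolding space_point_measure by (rule emeasure_point_measure_finite[OF Y]) simp
  also have "\<dots> = 1" using p by (simp add: sum_ennreal)
  finally have "prob_space ?N" by (rule prob_spaceI)
  then interpret N: prob_space ?N .
  interpret product_prob_space ?M UNIV ..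
  have tY: "t ! i \<in> Y" if "i < length t" for i using t that by auto
  have eq: "cylinder Y t = {x \<in> space (PiM UNIV ?M). \<forall>i\<in>{..<length t}. x i \<in> {t ! i}}"
    by (simp add: cylinder_def paths_eq space_PiM space_point_measure Ball_def)
  have "emeasure (bernoulli_measure Y p) (cylinder Y t) = (\<Prod>i<length t. emeasure ?N {t ! i})"
    unfolding bernoulli_measure_def eq
    by (rule emeasure_PiM_Collect) (simp_all add: sets_point_measure tY)
  also have "\<dots> = (\<Prod>i<length t. ennreal (p (t ! i)))"
    by (intro prod.cong refl) (simp add: emeasure_point_measure_finite Y tY)
  also have "\<dots> = ennreal (\<Prod>i<length t. p (t ! i))"
    by (rule prod_ennreal) (simp add: p tY)
  also have "(\<Prod>i<length t. p (t ! i)) = prod_list (map p t)"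
    by (simp add: prod.list_conv_set_nth atLeast0LessThan)
  finally show ?thesis .
qed


section \<open>The Cuntz algebra\<close>

definition word_isometry :: "('g \<Rightarrow> 'a::cstar_algebra) \<Rightarrow> 'g list \<Rightarrow> 'a" where
  "word_isometry V t = prod_list (map V t)"

text \<open>\<open>cuntz_algebra Y V\<close> states that the ambient C*-algebra is \<open>O\<^sub>Y\<close> with generators \<open>V s\<close>,
  \<open>s \<in> Y\<close>.\<close>

definition cuntz_algebra :: "'g set \<Rightarrow> ('g \<Rightarrow> 'a::cstar_algebra) \<Rightarrow> bool" where
  "cuntz_algebra Y V \<longleftrightarrow>
     (\<forall>s\<in>Y. star (V s) * V s = 1) \<and>
     (\<Sum>s\<in>Y. V s * star (V s)) = 1 \<and>
     cstar_generated (V ` Y) = UNIV"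

definition O_Y_G :: "('g, 'm) monoid_scheme \<Rightarrow> 'g set \<Rightarrow> ('g \<Rightarrow> 'a::cstar_algebra) \<Rightarrow> 'a set" where
  "O_Y_G G Y V = closed_cspan {word_isometry V t * star (word_isometry V u) | t u.
     t \<in> lists Y \<and> u \<in> lists Y \<and> word_eval G t = word_eval G u}"

definition gauge_flow ::
  "'g set \<Rightarrow> ('g \<Rightarrow> 'a::cstar_algebra) \<Rightarrow> ('g \<Rightarrow> real) \<Rightarrow> (real \<Rightarrow> 'a \<Rightarrow> 'a) \<Rightarrow> bool" where
  "gauge_flow Y V F \<alpha> \<longleftrightarrow>
     one_parameter_group \<alpha> \<and>
     (\<forall>r. \<forall>w\<in>lists Y. \<forall>u\<in>lists Y.
        \<alpha> r (word_isometry V w * star (word_isometry V u)) =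
        exp (\<i> * complex_of_real (r * (word_weight F w - word_weight F u))) *\<^sub>C
          (word_isometry V w * star (word_isometry V u)))"

definition diagonal :: "'g set \<Rightarrow> ('g \<Rightarrow> 'a::cstar_algebra) \<Rightarrow> 'a set" where
  "diagonal Y V = cstar_generated ((\<lambda>t. word_isometry V t * star (word_isometry V t)) ` lists Y)"

text \<open>\<open>diagonal_iso Y V \<Gamma>\<close>: the map \<open>\<Gamma>\<close> is the isometric *-isomorphism of the diagonal onto
  \<open>C(Y\<^sup>\<nat>)\<close> which takes \<open>V\<^sub>t V\<^sub>t\<^sup>*\<close> to the indicator function of \<open>tY\<^sup>\<nat>\<close>. Functions in \<open>C(Y\<^sup>\<nat>)\<close> are
  represented by functions on all of \<open>nat \<Rightarrow> 'g\<close> whose values off \<open>Y\<^sup>\<nat>\<close> are irrelevant.\<close>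

definition diagonal_iso ::
  "'g set \<Rightarrow> ('g \<Rightarrow> 'a::cstar_algebra) \<Rightarrow> ('a \<Rightarrow> (nat \<Rightarrow> 'g) \<Rightarrow> complex) \<Rightarrow> bool" where
  "diagonal_iso Y V \<Gamma> \<longleftrightarrow>
     (\<forall>d\<in>diagonal Y V. continuous_map (path_topology Y) euclidean (\<Gamma> d)) \<and>
     (\<forall>f. continuous_map (path_topology Y) euclidean f \<longrightarrow>
        (\<exists>d\<in>diagonal Y V. \<forall>x\<in>paths Y. \<Gamma> d x = f x)) \<and>
     (\<forall>d\<in>diagonal Y V. \<forall>d'\<in>diagonal Y V. \<forall>x\<in>paths Y.
        \<Gamma> (d + d') x = \<Gamma> d x + \<Gamma> d' x \<and> \<Gamma> (d * d') x = \<Gamma> d x * \<Gamma> d' x) \<and>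
     (\<forall>d\<in>diagonal Y V. \<forall>x\<in>paths Y.
        (\<forall>c. \<Gamma> (c *\<^sub>C d) x = c * \<Gamma> d x) \<and> \<Gamma> (star d) x = cnj (\<Gamma> d x)) \<and>
     (\<forall>d\<in>diagonal Y V. norm d = (SUP x\<in>paths Y. cmod (\<Gamma> d x))) \<and>
     (\<forall>t\<in>lists Y. \<forall>x\<in>paths Y.
        \<Gamma> (word_isometry V t * star (word_isometry V t)) x = indicator (cylinder Y t) x)"

definition diagonal_expectation :: "'g set \<Rightarrow> ('g \<Rightarrow> 'a::cstar_algebra) \<Rightarrow> ('a \<Rightarrow> 'a) \<Rightarrow> bool" where
  "diagonal_expectation Y V E \<longleftrightarrow>
     conditional_expectation (diagonal Y V) E \<and>
     (\<forall>t\<in>lists Y. \<forall>u\<in>lists Y.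
        E (word_isometry V t * star (word_isometry V u)) =
        (if t = u then word_isometry V t * star (word_isometry V t) else 0))"

definition KMS_measure ::
  "('g, 'm) monoid_scheme \<Rightarrow> 'g set \<Rightarrow> ('g \<Rightarrow> 'a::cstar_algebra) \<Rightarrow> (real \<Rightarrow> 'a \<Rightarrow> 'a) \<Rightarrow>
   ('a \<Rightarrow> 'a) \<Rightarrow> ('a \<Rightarrow> (nat \<Rightarrow> 'g) \<Rightarrow> complex) \<Rightarrow> real \<Rightarrow> (nat \<Rightarrow> 'g) measure \<Rightarrow> bool" where
  "KMS_measure G Y V \<alpha> E \<Gamma> \<beta> m \<longleftrightarrow>
     borel_prob_on_paths Y m \<and>
     KMS_state (O_Y_G G Y V) \<alpha> \<beta> (\<lambda>a. LINT x|m. \<Gamma> (E a) x)"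

end

theory Submission
  imports Defs "HOL-Complex_Analysis.Conformal_Mappings"
begin

text \<open>Put \<open>\<nu>(t) = m(tY\<^sup>\<nat>) e\<^sup>\<beta>\<^sup>F\<^sup>(\<^sup>t\<^sup>)\<close>. The KMS condition for \<open>V\<^sub>t V\<^sub>u\<^sup>*\<close> says that \<open>\<nu>(t)\<close>
  depends on the group element represented by \<open>t\<close> only, and \<open>m\<close> being abelian that it depends on the class in \<open>G/[G,G]\<close> only.
  Additivity of \<open>m\<close> makes \<open>\<nu>\<close> a function with finitely many values which is harmonic for the
  weights \<open>e\<^sup>-\<^sup>\<beta>\<^sup>F\<^sup>(\<^sup>s\<^sup>)\<close>; its extreme values force these weights to have sum \<open>1\<close> and \<open>\<nu>\<close> to be constant.
  Conversely, the KMS condition for the Bernoulli measure is a computation with words.\<close>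

section \<open>Automorphisms of C*-algebras are contractive\<close>

text \<open>A KMS state satisfies its identity only on some dense invariant subalgebra, which need
  not contain the elements \<open>V\<^sub>t V\<^sub>u\<^sup>*\<close>. Approximating them does not
  suffice by itself, because the value of the extension at \<open>\<i> * \<beta>\<close> need not
  depend continuously on the element. The way out is that these elements are eigenvectors of the
  flow: averages along the two boundary lines of the strip involve the flow at real times only,
  where errors stay uniform provided that the flow is contractive. Its automorphisms are given as
  purely algebraic maps, so contractivity has to be proved first.

  For the converse, the functional of the Bernoulli measure must be shown to be a state. Positivity
  is tested at one infinite word at a time: multiplication by a long enough prefix absorbs all
  adjoints, and distinct words become orthogonal.

  Finiteness of \<open>G/[G,G]\<close> lets \<nu> attain both extreme values although G itself may
  be infinite.\<close>

lemma scaleC_zero_left [simp]: "0 *\<^sub>C (x::'a::cstar_algebra) = 0"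
  using scaleC_of_real[of 0 x] by simp

lemma scaleC_one [simp]: "1 *\<^sub>C (x::'a::cstar_algebra) = x"
  using scaleC_of_real[of 1 x] by simp

lemma scaleC_zero_right [simp]: "c *\<^sub>C (0::'a::cstar_algebra) = 0"
  using scaleC_add_right[of c 0 "0::'a"] by simp

lemma scaleC_minus_right: "c *\<^sub>C (- x) = - (c *\<^sub>C (x::'a::cstar_algebra))"
  using scaleC_add_right[of c x "- x"] by (simp add: eq_neg_iff_add_eq_0 add.commute)

lemma scaleC_diff_right: "c *\<^sub>C (x - y) = c *\<^sub>C x - c *\<^sub>C (y::'a::cstar_algebra)"
  using scaleC_add_right[of c x "- y"] by (simp add: scaleC_minus_right)

lemma scaleC_minus_left: "(- c) *\<^sub>C x = - (c *\<^sub>C (x::'a::cstar_algebra))"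
  using scaleC_add_left[of c "- c" x] by (simp add: eq_neg_iff_add_eq_0 add.commute)

lemma scaleC_sum_right: "c *\<^sub>C sum f S = (\<Sum>i\<in>S. c *\<^sub>C (f i::'a::cstar_algebra))"
  by (induction S rule: infinite_finite_induct) (auto simp: scaleC_add_right)

lemma scaleC_diff_left: "(c - d) *\<^sub>C x = c *\<^sub>C x - d *\<^sub>C (x::'a::cstar_algebra)"
  using scaleC_add_left[of "c - d" d x] by (simp add: algebra_simps)

lemma star_zero [simp]: "star (0::'a::cstar_algebra) = 0"
  using star_add[of 0 "0::'a"] by simp

lemma star_one [simp]: "star (1::'a::cstar_algebra) = 1"
  by (metis mult.left_neutral mult.right_neutral star_mult star_star)

lemma star_sum: "star (sum f S) = (\<Sum>i\<in>S. star (f i::'a::cstar_algebra))"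
  by (induction S rule: infinite_finite_induct) (auto simp: star_add)

lemma norm_star [simp]: "norm (star x) = norm (x::'a::cstar_algebra)"
proof -
  have le: "norm y \<le> norm (star y)" for y :: 'a
  proof (cases "y = 0")
    case False
    have "norm y * norm y = norm (star y * y)" by (simp add: cstar_identity power2_eq_square)
    also have "\<dots> \<le> norm (star y) * norm y" by (rule norm_mult_ineq)
    finally show ?thesis using False by simp
  qed simp
  show ?thesis using le[of x] le[of "star x"] by (simp add: star_star)
qed

lemma bounded_linear_star: "bounded_linear (star :: 'a::cstar_algebra \<Rightarrow> 'a)"
proof (rule bounded_linear_intro[where K=1])
  show "star (r *\<^sub>R x) = r *\<^sub>R star x" for r and x :: 'a
    by (metis complex_cnj_complex_of_real scaleC_of_real star_scaleC)
qed (simp_all add: star_add)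

text \<open>The ratio of consecutive coefficients is \<open>(1/2 - n) / (n + 1)\<close>, of modulus
  at most 1. The bound makes the binomial series of the square root converge absolutely for
  \<open>norm x < 1\<close>.\<close>

lemma abs_gbinomial_half_le_1: "\<bar>(1/2::real) gchoose n\<bar> \<le> 1"
proof (induction n)
  case (Suc n)
  have "(1/2 - real n) * ((1/2) gchoose n) = real (Suc n) * ((1/2) gchoose Suc n)"
    using gbinomial_mult_1[of "1/2::real" n] by (simp add: algebra_simps)
  then have "real (Suc n) * \<bar>(1/2) gchoose Suc n\<bar> = \<bar>1/2 - real n\<bar> * \<bar>(1/2) gchoose n\<bar>"
    by (metis abs_mult abs_of_nat)
  also have "\<dots> \<le> real (Suc n) * 1"
    using Suc by (intro mult_mono) auto
  finally show ?case by (simp only: mult_le_cancel_left_pos of_nat_0_less_iff zero_less_Suc)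
qed simp

text \<open>The witness is the binomial series of the square root. By Vandermonde, its Cauchy square
  has the binomial coefficients of the exponent \<open>1/2 + 1/2\<close>, so only degrees 0 and 1
  survive. As a limit of real polynomials in \<open>x\<close>, the sum is selfadjoint and commutes
  with whatever commutes with \<open>x\<close>; the latter makes \<open>h\<close> commute with the
  root of \<open>1 - h * h\<close> below.\<close>

lemma exists_sqrt_one_minus:
  fixes x :: "'a::cstar_algebra"
  assumes x: "norm x < 1" and sx: "star x = x"
  obtains k where "star k = k" and "k * k = 1 - x" and "\<And>y. x * y = y * x \<Longrightarrow> k * y = y * k"
proof -
  define c where "c n = ((1/2::real) gchoose n) * (- 1) ^ n" for n
  define f where "f n = c n *\<^sub>R x ^ n" for n
  have "norm (f n) \<le> norm x ^ n" for n
  proof -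
    have "norm (f n) \<le> 1 * norm (x ^ n)"
      unfolding f_def c_def norm_scaleR
      by (rule mult_right_mono) (simp_all add: abs_mult abs_gbinomial_half_le_1)
    also have "\<dots> \<le> norm x ^ n" by (simp add: norm_power_ineq)
    finally show ?thesis .
  qed
  then have sn: "summable (\<lambda>n. norm (f n))"
    by (intro summable_comparison_test'[OF summable_geometric[of "norm x"], of 0])
       (use x in auto)
  then have sf: "summable f" by (rule summable_norm_cancel)
  let ?k = "suminf f"
  have "(\<Sum>i\<le>n. f i * f (n - i)) = (if n = 0 then 1 else if n = 1 then - x else 0)" for n
  proof -
    have "(\<Sum>i\<le>n. f i * f (n - i)) = (\<Sum>i\<le>n. (c i * c (n - i)) *\<^sub>R x ^ n)"
      by (intro sum.cong) (auto simp: f_def simp flip: power_add)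
    also have "\<dots> = (\<Sum>i\<le>n. c i * c (n - i)) *\<^sub>R x ^ n"
      by (simp add: scaleR_sum_left)
    also have "(\<Sum>i\<le>n. c i * c (n - i)) =
        (\<Sum>i\<le>n. ((1/2) gchoose i) * ((1/2) gchoose (n - i)) * (- 1) ^ n)"
      by (intro sum.cong) (auto simp: c_def simp flip: power_add)
    also have "\<dots> = ((1/2 + 1/2) gchoose n) * (- 1) ^ n"
      by (subst gbinomial_Vandermonde[symmetric]) (simp add: sum_distrib_right atLeast0AtMost)
    also have "((1/2 + 1/2::real) gchoose n) = of_nat (1 choose n)"
      by (simp add: binomial_gbinomial)
    finally have "(\<Sum>i\<le>n. f i * f (n - i)) = (of_nat (1 choose n) * (- 1) ^ n :: real) *\<^sub>R x ^ n" .
    moreover have "n = 0 \<or> n = 1 \<or> 1 choose n = 0" by (cases n) auto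
    ultimately show ?thesis by auto
  qed
  then have "(\<lambda>n. if n = 0 then 1 else if n = 1 then - x else 0) sums (?k * ?k)"
    using Cauchy_product_sums[OF sn sn] by simp
  moreover have "(\<lambda>n. if n = 0 then 1 else if n = 1 then - x else 0) sums
      (\<Sum>n\<in>{0, 1::nat}. if n = 0 then 1 else if n = 1 then - x else 0)"
    by (rule sums_finite) auto
  ultimately have "?k * ?k = 1 - x"
    using sums_unique2 by fastforce
  moreover have "star ?k = ?k"
  proof -
    have sp: "star (x ^ n) = x ^ n" for n
      by (induction n) (auto simp: star_mult sx power_commutes)
    have "star ?k = (\<Sum>n. star (f n))"
      by (rule bounded_linear.suminf[OF bounded_linear_star sf])
    also have "(\<lambda>n. star (f n)) = f"
      by (rule ext) (simp add: f_def bounded_linear.linear[OF bounded_linear_star, THEN linear_scale] sp)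
    finally show ?thesis .
  qed
  moreover have "?k * y = y * ?k" if y: "x * y = y * x" for y
  proof -
    have "x ^ n * y = y * x ^ n" for n using y by (metis power_commuting_commutes)
    then have "f n * y = y * f n" for n by (simp add: f_def)
    then show ?thesis
      using suminf_mult[OF sf, of y] suminf_mult2[OF sf, of y] by simp
  qed
  ultimately show thesis using that by blast
qed

lemma star_automorphism_one:
  assumes "star_automorphism \<phi>" shows "\<phi> 1 = 1"
proof -
  obtain x where "\<phi> x = 1" using assms by (metis star_automorphism_def bij_pointE)
  then show ?thesis using assms by (metis mult.right_neutral mult.left_neutral star_automorphism_def)
qed

text \<open>No continuity of \<open>\<phi>\<close> is available at this point. A selfadjoint \<open>h\<close> with \<open>norm h < 1\<close> is the
  real part of the unitary \<open>h + i sqrt (1 - h\<^sup>2)\<close>, and unitarity is an algebraic property.\<close>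

lemma star_automorphism_norm_le:
  fixes \<phi> :: "'a::cstar_algebra \<Rightarrow> 'a"
  assumes \<phi>: "star_automorphism \<phi>"
  shows "norm (\<phi> a) \<le> norm a"
proof -
  have add: "\<phi> (x + y) = \<phi> x + \<phi> y" and scale: "\<phi> (c *\<^sub>C x) = c *\<^sub>C \<phi> x"
    and mult: "\<phi> (x * y) = \<phi> x * \<phi> y" and st: "\<phi> (star x) = star (\<phi> x)" for x y c
    using \<phi> by (auto simp: star_automorphism_def clinear_op_def)
  have unitary: "norm u = 1" if "star u * u = 1" for u :: 'a
    using cstar_identity[of u] that by (simp add: power2_eq_1_iff) (metis norm_ge_zero not_one_le_zero neg_0_le_iff_le zero_le_one order_antisym)
  have contr: "norm (\<phi> h) \<le> 1" if h: "norm h < 1" "star h = h" for h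
  proof -
    have "norm (h * h) < 1"
      using h norm_mult_ineq[of h h] by (smt (verit) mult_left_le norm_ge_zero)
    then obtain k where k: "star k = k" "k * k = 1 - h * h" and c: "k * h = h * k"
      using exists_sqrt_one_minus[of "h * h"] h(2) by (metis mult.assoc star_mult)
    define u where "u = h + \<i> *\<^sub>C k"
    have su: "star u = h + (- \<i>) *\<^sub>C k"
      by (simp add: u_def star_add star_scaleC h k)
    \<comment> \<open>The mixed terms cancel because \<open>h\<close> and \<open>k\<close> commute,
      and \<open>h * h + k * k = 1\<close>.\<close>
    have 1: "star u * u = 1" and 2: "u * star u = 1"
      unfolding su by (simp_all add: u_def algebra_simps scaleC_mult_left scaleC_mult_right scaleC_scaleC k c
          scaleC_add_right scaleC_diff_right scaleC_minus_left) 
    have "norm (\<phi> u) = 1" "norm (\<phi> (star u)) = 1"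
      using 1 2 by (auto intro!: unitary simp: star_automorphism_one[OF \<phi>] star_star simp flip: st mult)
    moreover have "2 *\<^sub>R h = u + star u"
      by (simp add: su) (simp add: u_def scaleR_2 flip: scaleC_add_left)
    then have "complex_of_real 2 *\<^sub>C \<phi> h = \<phi> u + \<phi> (star u)"
      by (metis add scale scaleC_of_real)
    then have "2 *\<^sub>R \<phi> h = \<phi> u + \<phi> (star u)" by (simp only: scaleC_of_real)
    then have "2 * norm (\<phi> h) \<le> norm (\<phi> u) + norm (\<phi> (star u))"
      by (metis norm_triangle_ineq norm_scaleR abs_numeral)
    ultimately show ?thesis by simp
  qed
  have sa: "norm (\<phi> h) \<le> norm h" if h: "star h = h" for h
  proof (rule dense_ge)
    \<comment> \<open>Dividing by a number strictly above \<open>norm h\<close> meets the strict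
      bound in \<open>contr\<close> and covers \<open>h = 0\<close> as well.\<close>
    fix r assume r: "norm h < r"
    then have r0: "r > 0" by (meson norm_ge_zero order_le_less_trans)
    let ?h = "complex_of_real (inverse r) *\<^sub>C h"
    have "norm (\<phi> ?h) \<le> 1"
      using r r0 by (intro contr) (auto simp: norm_scaleC star_scaleC h field_simps norm_inverse norm_divide)
    then show "norm (\<phi> h) \<le> r" using r0 by (simp add: scale norm_scaleC field_simps norm_inverse norm_divide)
  qed
  \<comment> \<open>The C*-identity on both sides transfers the bound from the selfadjoint element
    \<open>star a * a\<close> to \<open>a\<close>.\<close>
  have "(norm (\<phi> a))\<^sup>2 = norm (\<phi> (star a * a))" by (simp add: mult st cstar_identity)
  also have "\<dots> \<le> norm (star a * a)" by (rule sa) (simp add: star_mult star_star)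
  also have "\<dots> = (norm a)\<^sup>2" by (rule cstar_identity)
  finally show ?thesis by (rule power2_le_imp_le) simp
qed

section \<open>Linear spans and entire functions\<close>

lemma csubspace_hull: "csubspace (csubspace hull X)"
  by (rule hull_in) (auto simp: csubspace_def)

text \<open>The sum is indexed by preimages in \<open>T\<close> and not by vectors: in the
  application the indices are words, and the orthogonality relations compare words.\<close>

lemma csubspace_hull_image_explicit:
  assumes "x \<in> csubspace hull (f ` T)"
  obtains S c where "finite S" "S \<subseteq> T" "x = (\<Sum>i\<in>S. c i *\<^sub>C f i)"
proof -
  define L where "L = {x. \<exists>S c. finite S \<and> S \<subseteq> T \<and> x = (\<Sum>i\<in>S. c i *\<^sub>C f i)}"
  have "csubspace L"
    unfolding csubspace_def
  proof (intro conjI ballI allI)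
    show "0 \<in> L" by (auto simp: L_def intro: exI[of _ "{}"])
  next
    fix x y assume "x \<in> L" "y \<in> L"
    then obtain S c S' c' where S: "finite S" "S \<subseteq> T" "x = (\<Sum>i\<in>S. c i *\<^sub>C f i)"
      and S': "finite S'" "S' \<subseteq> T" "y = (\<Sum>i\<in>S'. c' i *\<^sub>C f i)"
      by (auto simp: L_def)
    let ?c = "\<lambda>i. (if i \<in> S then c i else 0) + (if i \<in> S' then c' i else 0)"
    have "x = (\<Sum>i\<in>S \<union> S'. (if i \<in> S then c i else 0) *\<^sub>C f i)"
      unfolding S(3) by (rule sum.mono_neutral_cong_left) (use S S' in auto)
    moreover have "y = (\<Sum>i\<in>S \<union> S'. (if i \<in> S' then c' i else 0) *\<^sub>C f i)"
      unfolding S'(3) by (rule sum.mono_neutral_cong_left) (use S S' in auto)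
    ultimately have "x + y = (\<Sum>i\<in>S \<union> S'. ?c i *\<^sub>C f i)"
      by (simp only: scaleC_add_left sum.distrib)
    moreover have "finite (S \<union> S')" "S \<union> S' \<subseteq> T" using S S' by auto
    ultimately show "x + y \<in> L" unfolding L_def mem_Collect_eq by (intro exI conjI)
  next
    fix d x assume "x \<in> L"
    then obtain S c where S: "finite S" "S \<subseteq> T" "x = (\<Sum>i\<in>S. c i *\<^sub>C f i)"
      by (auto simp: L_def)
    have "d *\<^sub>C x = (\<Sum>i\<in>S. (d * c i) *\<^sub>C f i)"
      by (simp add: S(3) scaleC_sum_right scaleC_scaleC)
    then show "d *\<^sub>C x \<in> L" using S(1,2) unfolding L_def mem_Collect_eq by (intro exI conjI)
  qed
  moreover have "f ` T \<subseteq> L"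
  proof
    fix y assume "y \<in> f ` T"
    then obtain i where "i \<in> T" "y = f i" by auto
    then have "finite {i}" "{i} \<subseteq> T" "y = (\<Sum>j\<in>{i}. 1 *\<^sub>C f j)" by auto
    then show "y \<in> L" unfolding L_def by (intro CollectI exI[of _ "{i}"] exI[of _ "\<lambda>_. 1"]) blast
  qed
  ultimately have "csubspace hull (f ` T) \<subseteq> L" by (intro hull_minimal)
  then show thesis using assms that unfolding L_def by blast
qed

lemma csubspace_hull_mult:
  assumes "\<And>x y. x \<in> X \<Longrightarrow> y \<in> X \<Longrightarrow> x * y \<in> csubspace hull X"
    and a: "a \<in> csubspace hull X" and b: "b \<in> csubspace hull X"
  shows "a * b \<in> csubspace hull X"
proof -
  note H = csubspace_hull[of X, unfolded csubspace_def[of "csubspace hull X"]]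
  have "csubspace hull X \<subseteq> {b. x * b \<in> csubspace hull X}" if "x \<in> X" for x
    by (rule hull_minimal)
       (use that assms(1) H in \<open>auto simp: csubspace_def distrib_left scaleC_mult_right\<close>)
  then have "csubspace hull X \<subseteq> {a. \<forall>b\<in>csubspace hull X. a * b \<in> csubspace hull X}"
    by (intro hull_minimal)
       (use H in \<open>auto simp: csubspace_def distrib_right scaleC_mult_left\<close>)
  then show ?thesis using a b by blast
qed

lemma csubspace_hull_star:
  assumes "\<And>x. x \<in> X \<Longrightarrow> star x \<in> X" and a: "a \<in> csubspace hull X"
  shows "star a \<in> csubspace hull X"
proof -
  note H = csubspace_hull[of X, unfolded csubspace_def[of "csubspace hull X"]]
  have "csubspace hull X \<subseteq> {a. star a \<in> csubspace hull X}"
    by (rule hull_minimal)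
       (use assms(1) H in \<open>auto simp: csubspace_def star_add star_scaleC hull_inc\<close>)
  then show ?thesis using a by blast
qed

text \<open>\<open>bounded_linear\<close> is real linearity; together with \<open>scale\<close> the
  functional is complex linear, so complex difference quotients pass through it and scalar function
  theory applies.\<close>

lemma bounded_linear_compose_entire:
  assumes f: "entire f" and L: "bounded_linear L" and scale: "\<And>c x. L (c *\<^sub>C x) = c * L x"
  shows "(\<lambda>z. L (f z) :: complex) holomorphic_on UNIV"
  unfolding holomorphic_on_open[OF open_UNIV]
proof
  fix z
  obtain d where d: "((\<lambda>h. inverse h *\<^sub>C (f (z + h) - f z)) \<longlongrightarrow> d) (at 0)"
    using f by (auto simp: entire_def)
  have "((\<lambda>h. L (inverse h *\<^sub>C (f (z + h) - f z))) \<longlongrightarrow> L d) (at 0)"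
    by (rule bounded_linear.tendsto[OF L d])
  then have "((\<lambda>h. (L (f (z + h)) - L (f z)) / h) \<longlongrightarrow> L d) (at 0)"
    by (simp add: scale bounded_linear.linear[OF L, THEN linear_diff] divide_inverse mult.commute)
  then show "\<exists>f'. ((\<lambda>z. L (f z)) has_field_derivative f') (at z)"
    by (intro exI[of _ "L d"]) (simp add: DERIV_def)
qed

text \<open>The difference quotient converges, and multiplying it by the vanishing increment leaves
  the limit 0. Continuity later bounds an extension on the compact segment from 0 to
  \<open>\<i> * \<beta>\<close>.\<close>

lemma entire_isCont:
  assumes "entire f"
  shows "isCont f z"
proof -
  obtain d where d: "((\<lambda>h. inverse h *\<^sub>C (f (z + h) - f z)) \<longlongrightarrow> d) (at 0)"
    using assms by (auto simp: entire_def)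
  have "((\<lambda>h. cmod h * norm (inverse h *\<^sub>C (f (z + h) - f z))) \<longlongrightarrow> cmod 0 * norm d) (at 0)"
    by (intro tendsto_intros d)
  moreover have "\<forall>\<^sub>F h in at 0. cmod h * norm (inverse h *\<^sub>C (f (z + h) - f z)) = norm (f (z + h) - f z)"
    by (auto simp: eventually_at_filter norm_scaleC norm_inverse)
  ultimately have "((\<lambda>h. norm (f (z + h) - f z)) \<longlongrightarrow> 0) (at 0)"
    using Lim_transform_eventually by fastforce
  then have "((\<lambda>h. f (z + h) - f z) \<longlongrightarrow> 0) (at 0)" by (rule tendsto_norm_zero_cancel)
  then show ?thesis by (simp add: isCont_iff LIM_zero_iff)
qed

lemma tendsto_scaleC_left:
  assumes "(c \<longlongrightarrow> l) F"
  shows "((\<lambda>h. c h *\<^sub>C x) \<longlongrightarrow> l *\<^sub>C (x::'a::cstar_algebra)) F"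
proof -
  have "bounded_linear (\<lambda>c. c *\<^sub>C x)"
  proof (rule bounded_linear_intro[where K="norm x"])
    show "(r *\<^sub>R c) *\<^sub>C x = r *\<^sub>R (c *\<^sub>C x)" for r c
      by (simp only: scaleR_conv_of_real[where 'a=complex] scaleC_scaleC[symmetric] scaleC_of_real)
  qed (simp_all add: scaleC_add_left norm_scaleC)
  then show ?thesis using assms by (rule bounded_linear.tendsto)
qed

lemma tendsto_scaleC_right:
  assumes "(f \<longlongrightarrow> l) F"
  shows "((\<lambda>h. c *\<^sub>C f h) \<longlongrightarrow> c *\<^sub>C (l::'a::cstar_algebra)) F"
proof -
  have "bounded_linear (\<lambda>x::'a. c *\<^sub>C x)"
    by (rule bounded_linear_intro[where K="cmod c"])
       (simp_all add: scaleC_add_right norm_scaleC scaleC_scaleC mult.commute flip: scaleC_of_real)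
  then show ?thesis using assms by (rule bounded_linear.tendsto)
qed

lemma entire_add: "entire f \<Longrightarrow> entire g \<Longrightarrow> entire (\<lambda>z. f z + g z)"
  unfolding entire_def
proof safe
  fix z
  assume "\<forall>z. \<exists>d. ((\<lambda>h. inverse h *\<^sub>C (f (z + h) - f z)) \<longlongrightarrow> d) (at 0)"
    and "\<forall>z. \<exists>d. ((\<lambda>h. inverse h *\<^sub>C (g (z + h) - g z)) \<longlongrightarrow> d) (at 0)"
  then obtain d e where "((\<lambda>h. inverse h *\<^sub>C (f (z + h) - f z)) \<longlongrightarrow> d) (at 0)"
    and "((\<lambda>h. inverse h *\<^sub>C (g (z + h) - g z)) \<longlongrightarrow> e) (at 0)" by blast
  from tendsto_add[OF this] show "\<exists>d. ((\<lambda>h. inverse h *\<^sub>C (f (z + h) + g (z + h) - (f z + g z))) \<longlongrightarrow> d) (at 0)"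
    by (intro exI[of _ "d + e"]) (simp add: add_diff_add flip: scaleC_add_right)
qed

lemma entire_scaleC: "entire f \<Longrightarrow> entire (\<lambda>z. c *\<^sub>C f z)"
  unfolding entire_def
proof safe
  fix z
  assume "\<forall>z. \<exists>d. ((\<lambda>h. inverse h *\<^sub>C (f (z + h) - f z)) \<longlongrightarrow> d) (at 0)"
  then obtain d where "((\<lambda>h. inverse h *\<^sub>C (f (z + h) - f z)) \<longlongrightarrow> d) (at 0)" by blast
  from tendsto_scaleC_right[OF this, of c] show "\<exists>d. ((\<lambda>h. inverse h *\<^sub>C (c *\<^sub>C f (z + h) - c *\<^sub>C f z)) \<longlongrightarrow> d) (at 0)"
    by (intro exI[of _ "c *\<^sub>C d"]) (simp add: scaleC_scaleC mult.commute flip: scaleC_diff_right)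
qed

lemma entire_scaleC_left:
  assumes "g holomorphic_on UNIV"
  shows "entire (\<lambda>z. g z *\<^sub>C x)"
  unfolding entire_def
proof
  fix z
  obtain d where "(g has_field_derivative d) (at z)"
    using assms by (auto simp: holomorphic_on_open)
  then have "((\<lambda>h. (g (z + h) - g z) / h) \<longlongrightarrow> d) (at 0)" by (simp add: DERIV_def)
  from tendsto_scaleC_left[OF this, of x]
  show "\<exists>d. ((\<lambda>h. inverse h *\<^sub>C (g (z + h) *\<^sub>C x - g z *\<^sub>C x)) \<longlongrightarrow> d) (at 0)"
    by (intro exI[of _ "d *\<^sub>C x"])
       (simp add: scaleC_scaleC divide_inverse mult.commute flip: scaleC_diff_left)
qed

section \<open>KMS states on eigenvectors of the flow\<close>

text \<open>Cauchy's theorem on the rectangle with corners 0, \<open>T\<close>,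
  \<open>T + \<i> * b\<close> and \<open>\<i> * b\<close>, written with increments of a primitive
  \<open>H\<close>. The horizontal sides contribute \<open>c * T\<close> and \<open>d * T\<close> up
  to errors \<open>e * T\<close> and \<open>e' * T\<close>, while each vertical side contributes at
  most \<open>M * \<bar>b\<bar>\<close>, independently of \<open>T\<close>. Dividing by a large
  \<open>T\<close> removes the vertical sides.\<close>

lemma strip_boundary_values_close:
  fixes h :: "complex \<Rightarrow> complex"
  assumes h: "h holomorphic_on UNIV"
    and lower: "\<And>r. cmod (h (of_real r) - c) \<le> e"
    and upper: "\<And>r. cmod (h (of_real r + \<i> * of_real b) - d) \<le> e'"
    and bound: "\<And>r s. s \<in> closed_segment 0 b \<Longrightarrow> cmod (h (of_real r + \<i> * of_real s)) \<le> M"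
  shows "cmod (c - d) \<le> e + e'"
proof (rule field_le_epsilon)
  fix \<epsilon> :: real assume "\<epsilon> > 0"
  obtain H where H: "\<And>z. (H has_field_derivative h z) (at z)"
    using holomorphic_convex_primitive'[OF convex_UNIV open_UNIV h] by auto
  have side: "cmod (H z - H w - k * (z - w)) \<le> K * cmod (z - w)"
    if "\<And>y. y \<in> closed_segment w z \<Longrightarrow> cmod (h y - k) \<le> K" for z w k K
  proof -
    have "cmod ((H z - k * z) - (H w - k * w)) \<le> K * cmod (z - w)"
    proof (rule field_differentiable_bound)
      show "convex (closed_segment w z)" by (rule convex_closed_segment)
      show "((\<lambda>z. H z - k * z) has_field_derivative (h y - k)) (at y within closed_segment w z)"
        if "y \<in> closed_segment w z" for y
        by (rule has_field_derivative_at_within) (auto intro!: derivative_eq_intros H)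
    qed (use that in auto)
    then show ?thesis by (simp add: algebra_simps)
  qed
  have M: "M \<ge> 0" using bound[of 0 0] by (meson norm_ge_zero order_trans ends_in_segment(1))
  \<comment> \<open>This makes \<open>2 * M * \<bar>b\<bar> \<le> \<epsilon> * T\<close>; the
    summand 1 keeps \<open>T\<close> positive when \<open>M\<close> or \<open>b\<close> is
    0.\<close>
  define T where "T = 2 * M * \<bar>b\<bar> / \<epsilon> + 1"
  have T: "T > 0" using M \<open>\<epsilon> > 0\<close> by (simp add: T_def add_nonneg_pos)
  let ?T = "complex_of_real T" and ?b = "\<i> * complex_of_real b"
  have horizontal: "\<exists>r. y = of_real r + s" if "y \<in> closed_segment s (?T + s)" for y s
  proof -
    from that obtain u :: real where "y = (1 - u) *\<^sub>R s + u *\<^sub>R (?T + s)"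
      by (auto simp: in_segment)
    then have "y = of_real (u * T) + s" by (simp add: scaleR_conv_of_real algebra_simps)
    then show ?thesis by blast
  qed
  have vertical: "\<exists>r\<in>closed_segment 0 b. y = s + \<i> * of_real r"
    if "y \<in> closed_segment s (s + ?b)" for y s
  proof -
    from that obtain u :: real where u: "0 \<le> u" "u \<le> 1" "y = (1 - u) *\<^sub>R s + u *\<^sub>R (s + ?b)"
      by (auto simp: in_segment)
    then have "y = s + \<i> * of_real (u * b)" by (simp add: scaleR_conv_of_real algebra_simps)
    moreover have "u * b \<in> closed_segment 0 b" using u by (auto simp: in_segment)
    ultimately show ?thesis by blast
  qed
  have 1: "cmod (H ?T - H 0 - c * ?T) \<le> e * T"
    using side[of 0 "?T" c e] horizontal[of _ 0] lower T by fastforce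
  have 2: "cmod (H (?T + ?b) - H ?b - d * ?T) \<le> e' * T"
    using side[of "?b" "?T + ?b" d e'] horizontal[of _ ?b] upper T by fastforce
  have 3: "cmod (H ?b - H 0) \<le> M * \<bar>b\<bar>"
    using side[of 0 "0 + ?b" 0 M] vertical[of _ 0] bound[of _ 0] by (fastforce simp: norm_mult)
  have 4: "cmod (H (?T + ?b) - H ?T) \<le> M * \<bar>b\<bar>"
    using side[of ?T "?T + ?b" 0 M] vertical[of _ ?T] bound[of _ T] by (fastforce simp: norm_mult)
  have tri: "cmod (p - q - u + v) \<le> cmod p + cmod q + cmod u + cmod v" for p q u v
    using norm_triangle_ineq[of "p - q - u" v] norm_triangle_ineq4[of "p - q" u]
      norm_triangle_ineq4[of p q] by linarith
  have "(c - d) * ?T = (H (?T + ?b) - H ?b - d * ?T) - (H ?T - H 0 - c * ?T)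
      - (H (?T + ?b) - H ?T) + (H ?b - H 0)"
    by (simp add: algebra_simps)
  then have "cmod ((c - d) * ?T) \<le> cmod (H (?T + ?b) - H ?b - d * ?T) + cmod (H ?T - H 0 - c * ?T)
      + cmod (H (?T + ?b) - H ?T) + cmod (H ?b - H 0)"
    by (simp only:) (rule tri)
  also have "\<dots> \<le> e' * T + e * T + M * \<bar>b\<bar> + M * \<bar>b\<bar>"
    using 1 2 3 4 by linarith
  also have "\<dots> \<le> e' * T + e * T + \<epsilon> * T"
    using \<open>\<epsilon> > 0\<close> by (simp add: T_def field_simps)
  finally have "cmod ((c - d) * ?T) \<le> (e + e' + \<epsilon>) * T" by (simp only: distrib_right add_ac)
  then have "cmod (c - d) * T \<le> (e + e' + \<epsilon>) * T"
    using T unfolding norm_mult by simp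
  then show "cmod (c - d) \<le> e + e' + \<epsilon>" using T by simp
qed

text \<open>The identity theorem, with 0 as a limit point of the real line. It carries the group law
  of the flow from real to complex parameters.\<close>

lemma entire_eq_on_reals:
  fixes f g :: "complex \<Rightarrow> complex"
  assumes "f holomorphic_on UNIV" "g holomorphic_on UNIV" "\<And>r. f (of_real r) = g (of_real r)"
  shows "f z = g z"
proof -
  have "(0::complex) islimpt range of_real"
    unfolding islimpt_approachable
  proof (intro allI impI)
    fix e :: real assume "e > 0"
    then show "\<exists>y\<in>range of_real. y \<noteq> 0 \<and> dist y (0::complex) < e"
      by (intro bexI[of _ "of_real (e / 2)"] rangeI) (simp_all add: norm_divide)
  qed
  then have "f z - g z = 0"
    by (rule analytic_continuation[of "\<lambda>z. f z - g z" UNIV "range of_real", rotated 5])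
       (use assms in \<open>auto intro: holomorphic_on_diff\<close>)
  then show ?thesis by simp
qed

text \<open>The mean of \<open>r \<mapsto> e\<^sup>-\<^sup>i\<^sup>\<lambda>\<^sup>r \<omega> (b * \<alpha>\<^sub>r a)\<close> over a long interval does not change, up to the factor
  \<open>e\<^sup>\<lambda>\<^sup>\<beta>\<close>, when the line of integration is moved by \<open>i\<beta>\<close>. The dense subalgebra in the definition of a
  KMS state need not contain \<open>a0\<close>, but on both lines the integrand stays uniformly close to its
  value at \<open>a = a0\<close>.\<close>

lemma KMS_state_eigenvector:
  fixes \<omega> :: "'a::cstar_algebra \<Rightarrow> complex"
  assumes \<alpha>: "one_parameter_group \<alpha>" and KMS: "KMS_state B \<alpha> \<beta> \<omega>"
    and add: "\<And>x y. \<omega> (x + y) = \<omega> x + \<omega> y" and scale: "\<And>c x. \<omega> (c *\<^sub>C x) = c * \<omega> x"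
    and bound: "\<And>x. cmod (\<omega> x) \<le> norm x"
    and eigen: "\<And>r. \<alpha> r a0 = exp (\<i> * complex_of_real (r * l)) *\<^sub>C a0"
    and a0: "a0 \<in> B" and b0: "b0 \<in> B"
  shows "\<omega> (b0 * a0) = complex_of_real (exp (\<beta> * l)) * \<omega> (a0 * b0)"
proof -
  obtain A where A: "B \<subseteq> closure A" and A': "\<forall>r. \<alpha> r ` A \<subseteq> A"
    and ext': "\<forall>a\<in>A. \<exists>f. analytic_extension B \<alpha> a f \<and>
           (\<forall>b\<in>A. \<omega> (a * b) = \<omega> (b * f (\<i> * complex_of_real \<beta>)))"
    using KMS unfolding KMS_state_def by (elim conjE exE) (rule that)
  note ext = bspec[OF ext']
  have auto: "star_automorphism (\<alpha> r)" for r
    using \<alpha> by (simp add: one_parameter_group_def)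
  have lin: "clinear_op (\<alpha> r)" for r
    using auto[of r] by (simp only: star_automorphism_def)
  have \<alpha>_add: "\<alpha> r (x + y) = \<alpha> r x + \<alpha> r y" for r x y
    using lin[of r] by (simp only: clinear_op_def)
  have \<alpha>_scale: "\<alpha> r (c *\<^sub>C x) = c *\<^sub>C \<alpha> r x" for r c x
    using lin[of r] by (simp only: clinear_op_def)
  have \<alpha>_diff: "\<alpha> r (x - y) = \<alpha> r x - \<alpha> r y" for r x y
    using \<alpha>_add[of r "x - y" y] by simp
  have \<alpha>_norm: "norm (\<alpha> r x) \<le> norm x" for r x
    by (rule star_automorphism_norm_le[OF auto])
  have \<alpha>_group: "\<alpha> r (\<alpha> s x) = \<alpha> (r + s) x" for r s x
    using \<alpha> by (simp add: one_parameter_group_def)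
  have diff: "\<omega> (x - y) = \<omega> x - \<omega> y" for x y
    using add[of "x - y" y] by simp
  have bl: "bounded_linear (\<lambda>x. \<omega> (T x))"
    if "\<And>x y. T (x + y) = T x + T y" "\<And>c x. T (c *\<^sub>C x) = c *\<^sub>C T x" "\<And>x. norm (T x) \<le> norm x * K"
    for T K
  proof (rule bounded_linear_intro[where K=K])
    show "\<omega> (T (r *\<^sub>R x)) = r *\<^sub>R \<omega> (T x)" for r x
      using that(2)[of "complex_of_real r" x] scale[of "complex_of_real r" "T x"]
      by (simp add: scaleC_of_real scaleR_conv_of_real)
    show "norm (\<omega> (T x)) \<le> norm x * K" for x
      using bound[of "T x"] that(3)[of x] by linarith
  qed (simp add: that add)
  have \<omega>_bl: "bounded_linear \<omega>"
    using bl[of "\<lambda>x. x" 1] by simp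
  let ?c = "complex_of_real (exp (\<beta> * l))"
  have estimate: "cmod (\<omega> (b * a0) - ?c * \<omega> (a0 * b)) \<le> (1 + exp (\<beta> * l)) * (norm b * norm (a - a0))"
    if a: "a \<in> A" and b: "b \<in> A" for a b
  proof -
    obtain f where f: "entire f" "\<And>r. f (complex_of_real r) = \<alpha> r a"
      using ext[OF a] by (auto simp: analytic_extension_def)
    have bT: "norm (b * \<alpha> r x) \<le> norm x * norm b" for r x
      using norm_mult_ineq[of b "\<alpha> r x"] mult_left_mono[OF \<alpha>_norm[of r x] norm_ge_zero[of b]]
      by (simp add: mult.commute)
    have L: "bounded_linear (\<lambda>x. \<omega> (b * \<alpha> r x))" for r
      by (rule bl[of _ "norm b"]) (simp_all add: \<alpha>_add \<alpha>_scale distrib_left scaleC_mult_right bT)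
    have \<alpha>0: "\<alpha> 0 x = x" for x using \<alpha> by (simp add: one_parameter_group_def)
    have hol: "(\<lambda>z. \<omega> (b * \<alpha> r (f' z))) holomorphic_on UNIV" if "entire f'" for r f'
      by (rule bounded_linear_compose_entire[OF that L]) (simp add: \<alpha>_scale scaleC_mult_right scale)
    define g where "g z = \<omega> (b * f z)" for z
    have g: "g holomorphic_on UNIV" using hol[OF f(1), of 0] by (simp add: g_def[abs_def] \<alpha>0)
    have g_shift: "(\<lambda>w. g (of_real r + w)) holomorphic_on UNIV" for r
      using holomorphic_on_compose_gen[OF _ g, of "\<lambda>w. of_real r + w" UNIV]
      by (simp add: o_def holomorphic_on_add)
    \<comment> \<open>A real translation of the argument can be carried out by the flow: for real
      \<open>w\<close> this is the group law, and both sides are entire in \<open>w\<close>.\<close>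
    have shift: "g (of_real r + w) = \<omega> (b * \<alpha> r (f w))" for r w
    proof (rule entire_eq_on_reals[OF g_shift hol[OF f(1)]])
      show "g (of_real r + of_real s) = \<omega> (b * \<alpha> r (f (of_real s)))" for s
        using f(2)[of "r + s"] by (simp add: g_def f(2) \<alpha>_group)
    qed
    \<comment> \<open>The KMS identity is applied to \<open>\<alpha> r a\<close>, which lies in
      \<open>A\<close> by invariance; its extension is compared with the translate of
      \<open>f\<close>. The map \<open>\<alpha> 0\<close> is inserted so that \<open>hol\<close>
      applies.\<close>
    have upper_line: "g (of_real r + \<i> * of_real \<beta>) = \<omega> (\<alpha> r a * b)" for r
    proof -
      have "\<alpha> r a \<in> A" using A' a by blast
      then obtain f' where f': "entire f'" "\<And>s. f' (complex_of_real s) = \<alpha> s (\<alpha> r a)"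
        and KMS': "\<omega> (\<alpha> r a * b) = \<omega> (b * f' (\<i> * complex_of_real \<beta>))"
        using ext[of "\<alpha> r a"] b by (auto simp: analytic_extension_def)
      have "g (of_real r + w) = \<omega> (b * \<alpha> 0 (f' w))" for w
      proof (rule entire_eq_on_reals[OF g_shift hol[OF f'(1)]])
        show "g (of_real r + of_real s) = \<omega> (b * \<alpha> 0 (f' (of_real s)))" for s
          using f(2)[of "r + s"] by (simp add: g_def f'(2) \<alpha>_group add.commute)
      qed
      then show ?thesis by (simp add: KMS' \<alpha>0)
    qed
    \<comment> \<open>The exponential cancels the phase by which the flow multiplies
      \<open>a0\<close>, so that for \<open>a = a0\<close> both boundary values would be constant.
      Its modulus at height \<beta> is the source of the factor
      \<open>exp (\<beta> * l)\<close>.\<close>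
    define h where "h z = exp (- (\<i> * of_real l * z)) * g z" for z
    have norm_exp: "cmod (exp (- (\<i> * of_real l * (of_real r + \<i> * of_real s)))) = exp (l * s)" for r s
      by (simp add: norm_exp_eq_Re)
    have "h holomorphic_on UNIV"
      unfolding h_def[abs_def] by (intro holomorphic_intros g)
    moreover have "cmod (h (of_real r) - \<omega> (b * a0)) \<le> norm b * norm (a - a0)" for r
    proof -
      let ?e = "exp (- (\<i> * of_real l * of_real r))"
      have "?e * exp (\<i> * complex_of_real (r * l)) = 1"
        by (simp add: mult_ac flip: exp_add)
      then have "\<omega> (b * a0) = ?e * \<omega> (b * \<alpha> r a0)"
        by (simp add: eigen scaleC_mult_right scale flip: mult.assoc)
      then have "h (of_real r) - \<omega> (b * a0) = ?e * \<omega> (b * \<alpha> r (a - a0))"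
        by (simp add: h_def g_def f(2) \<alpha>_diff right_diff_distrib diff)
      moreover have "cmod ?e = 1" using norm_exp[of r 0] by simp
      ultimately have "cmod (h (of_real r) - \<omega> (b * a0)) = cmod (\<omega> (b * \<alpha> r (a - a0)))"
        by (simp add: norm_mult)
      then show ?thesis
        using bound[of "b * \<alpha> r (a - a0)"] bT[of r "a - a0"] by (simp add: mult.commute)
    qed
    moreover have "cmod (h (of_real r + \<i> * of_real \<beta>) - ?c * \<omega> (a0 * b))
        \<le> exp (\<beta> * l) * (norm b * norm (a - a0))" for r
    proof -
      let ?e = "exp (- (\<i> * of_real l * of_real r))"
      have "?e * exp (\<i> * complex_of_real (r * l)) = 1"
        by (simp add: mult_ac flip: exp_add)
      then have 1: "\<omega> (a0 * b) = ?e * \<omega> (\<alpha> r a0 * b)"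
        by (simp add: eigen scaleC_mult_left scale flip: mult.assoc)
      have "exp (- (\<i> * of_real l * (of_real r + \<i> * of_real \<beta>))) = ?c * ?e"
        by (simp add: exp_of_real[symmetric] algebra_simps flip: exp_add)
      then have "h (of_real r + \<i> * of_real \<beta>) - ?c * \<omega> (a0 * b) = ?c * (?e * \<omega> (\<alpha> r (a - a0) * b))"
        by (simp add: h_def upper_line 1 \<alpha>_diff left_diff_distrib right_diff_distrib diff mult.assoc)
      moreover have "cmod ?e = 1" using norm_exp[of r 0] by simp
      ultimately have "cmod (h (of_real r + \<i> * of_real \<beta>) - ?c * \<omega> (a0 * b)) =
          exp (\<beta> * l) * cmod (\<omega> (\<alpha> r (a - a0) * b))"
        by (simp add: norm_mult)
      moreover have "cmod (\<omega> (\<alpha> r (a - a0) * b)) \<le> norm b * norm (a - a0)"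
        using bound[of "\<alpha> r (a - a0) * b"] norm_mult_ineq[of "\<alpha> r (a - a0)" b]
          mult_right_mono[OF \<alpha>_norm[of r "a - a0"] norm_ge_zero[of b]]
        by (simp add: mult.commute)
      ultimately show ?thesis by (simp add: mult_left_mono)
    qed
    \<comment> \<open>By \<open>shift\<close>, the whole strip is controlled by the values of
      \<open>f\<close> on one vertical segment, since the flow is contractive.\<close>
    moreover obtain M where M: "\<And>r s. s \<in> closed_segment 0 \<beta> \<Longrightarrow> cmod (h (of_real r + \<i> * of_real s)) \<le> M"
    proof -
      have "continuous_on (closed_segment 0 \<beta>) (\<lambda>s. f (\<i> * of_real s))"
        by (intro continuous_at_imp_continuous_on ballI
            isCont_o2[where f="\<lambda>s. \<i> * complex_of_real s" and g=f] entire_isCont f(1))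
           (auto intro!: continuous_intros)
      then have "bounded ((\<lambda>s. f (\<i> * of_real s)) ` closed_segment 0 \<beta>)"
        by (intro compact_imp_bounded compact_continuous_image) auto
      then obtain K where K: "\<And>s. s \<in> closed_segment 0 \<beta> \<Longrightarrow> norm (f (\<i> * of_real s)) \<le> K"
        by (auto simp: bounded_iff)
      have "cmod (h (of_real r + \<i> * of_real s)) \<le> exp (\<bar>l\<bar> * \<bar>\<beta>\<bar>) * (K * norm b)"
        if s: "s \<in> closed_segment 0 \<beta>" for r s
      proof -
        have "cmod (h (of_real r + \<i> * of_real s)) = exp (l * s) * cmod (\<omega> (b * \<alpha> r (f (\<i> * of_real s))))"
          by (simp only: h_def norm_mult norm_exp shift)
        also have "\<dots> \<le> exp (\<bar>l\<bar> * \<bar>\<beta>\<bar>) * (K * norm b)"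
        proof (rule mult_mono)
          have "\<bar>s\<bar> \<le> \<bar>\<beta>\<bar>" using s by (auto simp: closed_segment_eq_real_ivl split: if_splits)
          then have "\<bar>l * s\<bar> \<le> \<bar>l\<bar> * \<bar>\<beta>\<bar>" by (simp add: abs_mult mult_left_mono)
          then show "exp (l * s) \<le> exp (\<bar>l\<bar> * \<bar>\<beta>\<bar>)" by simp
          show "cmod (\<omega> (b * \<alpha> r (f (\<i> * of_real s)))) \<le> K * norm b"
            using bound[of "b * \<alpha> r (f (\<i> * of_real s))"] bT[of r "f (\<i> * of_real s)"]
              mult_right_mono[OF K[OF s] norm_ge_zero[of b]] by linarith
        qed auto
        finally show ?thesis .
      qed
      then show thesis by (rule that)
    qed
    ultimately have "cmod (\<omega> (b * a0) - ?c * \<omega> (a0 * b)) \<le>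
        norm b * norm (a - a0) + exp (\<beta> * l) * (norm b * norm (a - a0))"
      by (rule strip_boundary_values_close)
    then show ?thesis by (simp add: distrib_right)
  qed
  \<comment> \<open>Neither \<open>a0\<close> nor \<open>b0\<close> need lie in \<open>A\<close>.
    Along the approximating sequences the error keeps the factor \<open>norm (an n - a0)\<close>,
    which tends to 0.\<close>
  obtain an bn where an: "\<And>n. an n \<in> A" "an \<longlonglongrightarrow> a0" and bn: "\<And>n. bn n \<in> A" "bn \<longlonglongrightarrow> b0"
    using subsetD[OF A a0] subsetD[OF A b0] unfolding closure_sequential by blast
  have "(\<lambda>n. cmod (\<omega> (bn n * a0) - ?c * \<omega> (a0 * bn n))) \<longlonglongrightarrow> cmod (\<omega> (b0 * a0) - ?c * \<omega> (a0 * b0))"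
    by (intro tendsto_intros bounded_linear.tendsto[OF \<omega>_bl] bn)
  moreover have "(\<lambda>n. (1 + exp (\<beta> * l)) * (norm (bn n) * norm (an n - a0))) \<longlonglongrightarrow>
      (1 + exp (\<beta> * l)) * (norm b0 * norm (a0 - a0))"
    by (intro tendsto_intros bn an)
  ultimately have "cmod (\<omega> (b0 * a0) - ?c * \<omega> (a0 * b0)) \<le> (1 + exp (\<beta> * l)) * (norm b0 * norm (a0 - a0))"
    by (rule LIMSEQ_le) (use estimate an bn in blast)
  then show ?thesis by simp
qed

section \<open>Cylinder sets and Borel probability measures on infinite words\<close>

text \<open>An infinite word in both cylinders forces the two words to agree up to the shorter
  length, so one is a prefix of the other. This case distinction underlies every evaluation of
  \<open>star (W u) * W s\<close> below.\<close>

lemma cylinder_append_disjoint_cases: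
  assumes "t \<in> lists Y" "u \<in> lists Y"
  obtains (left) y where "y \<in> lists Y" "u = t @ y"
    | (right) y where "y \<in> lists Y" "t = u @ y"
    | (disjoint) "cylinder Y t \<inter> cylinder Y u = {}"
proof (cases "\<exists>x. x \<in> cylinder Y t \<inter> cylinder Y u")
  case True
  then obtain x where "\<forall>i<length t. x i = t ! i" "\<forall>i<length u. x i = u ! i"
    by (auto simp: cylinder_def)
  then have eq: "t ! i = u ! i" if "i < length t" "i < length u" for i using that by metis
  show thesis
  proof (cases "length t \<le> length u")
    case True
    then have "take (length t) u = t" using eq by (auto intro!: nth_equalityI)
    then have "u = t @ drop (length t) u" by (metis append_take_drop_id)
    then show thesis using left assms by (metis append_in_lists_conv)
  next
    case False
    then have "take (length u) t = u" using eq by (auto intro!: nth_equalityI)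
    then have "t = u @ drop (length u) t" by (metis append_take_drop_id)
    then show thesis using right assms by (metis append_in_lists_conv)
  qed
qed (use disjoint in blast)

lemma cylinder_nonempty:
  assumes "Y \<noteq> {}" "t \<in> lists Y"
  shows "cylinder Y t \<noteq> {}"
proof -
  obtain y where "y \<in> Y" using assms(1) by auto
  then have "(\<lambda>i. if i < length t then t ! i else y) \<in> cylinder Y t"
    using assms(2) by (auto simp: cylinder_def paths_eq)
  then show ?thesis by blast
qed

lemma cylinder_subset_paths: "cylinder Y t \<subseteq> paths Y"
  by (auto simp: cylinder_def)

lemma cylinder_Nil: "cylinder Y [] = paths Y"
  by (auto simp: cylinder_def)

lemma cylinder_append_subset: "cylinder Y (t @ u) \<subseteq> cylinder Y t"
  by (auto simp: cylinder_def nth_append)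

lemma cylinder_eq_UN_children:
  assumes "t \<in> lists Y"
  shows "cylinder Y t = (\<Union>s\<in>Y. cylinder Y (t @ [s]))"
proof
  show "cylinder Y t \<subseteq> (\<Union>s\<in>Y. cylinder Y (t @ [s]))"
  proof
    fix x assume x: "x \<in> cylinder Y t"
    then have "x (length t) \<in> Y" by (auto simp: cylinder_def paths_eq PiE_iff)
    moreover have "x \<in> cylinder Y (t @ [x (length t)])"
      using x by (auto simp: cylinder_def nth_append less_Suc_eq)
    ultimately show "x \<in> (\<Union>s\<in>Y. cylinder Y (t @ [s]))" by blast
  qed
qed (use cylinder_append_subset in fast)

text \<open>A condition on coordinate \<open>i\<close> selects finitely many cylinders of length
  \<open>Suc i\<close>, the least length that fixes this coordinate. The empty set is adjoined
  because disjoint cylinders must have their intersection in the generator.\<close>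

lemma sets_path_borel_eq_sigma_cylinders:
  assumes "finite Y"
  shows "sets (path_borel Y) = sigma_sets (paths Y) (insert {} (cylinder Y ` lists Y))"
    (is "_ = sigma_sets _ ?C")
proof
  interpret S: sigma_algebra "paths Y" "sigma_sets (paths Y) ?C"
    by (rule sigma_algebra_sigma_sets) (use cylinder_subset_paths in blast)
  have "{x \<in> paths Y. x i \<in> A} \<in> sigma_sets (paths Y) ?C" if A: "A \<subseteq> Y" for i A
  proof -
    let ?T = "{t \<in> lists Y. length t = Suc i \<and> t ! i \<in> A}"
    have fin: "finite ?T"
      by (rule finite_subset[OF _ finite_lists_length_eq[OF assms, of "Suc i"]]) auto
    have "{x \<in> paths Y. x i \<in> A} = (\<Union>t\<in>?T. cylinder Y t)"
    proof (intro equalityI subsetI)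
      fix x assume x: "x \<in> {x \<in> paths Y. x i \<in> A}"
      then have "map x [0..<Suc i] \<in> ?T" "x \<in> cylinder Y (map x [0..<Suc i])"
        by (auto simp: cylinder_def paths_eq PiE_iff nth_append simp del: upt_Suc)
      then show "x \<in> (\<Union>t\<in>?T. cylinder Y t)" by blast
    qed (auto simp: cylinder_def)
    also have "\<dots> \<in> sigma_sets (paths Y) ?C"
      by (intro S.finite_UN fin sigma_sets.Basic) auto
    finally show ?thesis .
  qed
  then show "sets (path_borel Y) \<subseteq> sigma_sets (paths Y) ?C"
    unfolding sets_path_borel[OF assms] sets_PiM_single space_count_space paths_eq[symmetric] sets_count_space
    by (intro S.sigma_sets_subset) auto
  have "cylinder Y t \<in> sets (path_borel Y)" if t: "t \<in> lists Y" for t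
  proof -
    have "cylinder Y t = {x \<in> space (\<Pi>\<^sub>M i\<in>(UNIV::nat set). count_space Y). \<forall>i\<in>{..<length t}. x i = t ! i}"
      by (auto simp: cylinder_def space_PiM paths_eq)
    also have "\<dots> \<in> sets (\<Pi>\<^sub>M i\<in>(UNIV::nat set). count_space Y)"
    proof (rule sets.sets_Collect_finite_All)
      fix i assume "i \<in> {..<length t}"
      then have "t ! i \<in> Y" using t by auto
      then show "{x \<in> space (\<Pi>\<^sub>M i\<in>(UNIV::nat set). count_space Y). x i = t ! i} \<in> sets (\<Pi>\<^sub>M i\<in>(UNIV::nat set). count_space Y)"
        using measurable_sets[OF measurable_component_singleton[of i UNIV "\<lambda>_. count_space Y"], of "{t ! i}"]
        by (simp add: vimage_def Int_def conj_commute)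
    qed simp
    finally show ?thesis by (simp add: sets_path_borel[OF assms])
  qed
  moreover have "space (path_borel Y) = paths Y"
    using sets_eq_imp_space_eq[OF sets_path_borel[OF assms]] by (simp add: space_PiM paths_eq)
  ultimately show "sigma_sets (paths Y) ?C \<subseteq> sets (path_borel Y)"
    using sets.sigma_sets_subset[of ?C "path_borel Y"] by auto
qed

lemma Int_stable_cylinders: "Int_stable (insert {} (cylinder Y ` lists Y))"
  unfolding Int_stable_def
proof (intro ballI)
  fix a b assume "a \<in> insert {} (cylinder Y ` lists Y)" "b \<in> insert {} (cylinder Y ` lists Y)"
  then consider "a \<inter> b = {}" | t u where "t \<in> lists Y" "u \<in> lists Y" "a = cylinder Y t" "b = cylinder Y u"
    by auto
  then show "a \<inter> b \<in> insert {} (cylinder Y ` lists Y)"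
  proof cases
    case 2
    from 2(1,2) show ?thesis
    proof (cases rule: cylinder_append_disjoint_cases)
      case (left y)
      then have "a \<inter> b = cylinder Y u" using cylinder_append_subset[of Y t y] 2 by auto
      then show ?thesis using 2 by auto
    next
      case (right y)
      then have "a \<inter> b = cylinder Y t" using cylinder_append_subset[of Y u y] 2 by auto
      then show ?thesis using 2 by auto
    qed (use 2 in auto)
  qed auto
qed

lemma borel_prob_on_paths_eqI:
  assumes Y: "finite Y" and m: "borel_prob_on_paths Y m" and m': "borel_prob_on_paths Y m'"
    and eq: "\<And>t. t \<in> lists Y \<Longrightarrow> emeasure m (cylinder Y t) = emeasure m' (cylinder Y t)"
  shows "m = m'"
proof (rule measure_eqI_generator_eq[OF Int_stable_cylinders])
  show "insert {} (cylinder Y ` lists Y) \<subseteq> Pow (paths Y)" using cylinder_subset_paths by blast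
  show "sets m = sigma_sets (paths Y) (insert {} (cylinder Y ` lists Y))"
    and "sets m' = sigma_sets (paths Y) (insert {} (cylinder Y ` lists Y))"
    using m m' sets_path_borel_eq_sigma_cylinders[OF Y] by (simp_all add: borel_prob_on_paths_def)
  \<comment> \<open>The whole space is the cylinder of the empty word, so a constant sequence
    exhausts it.\<close>
  show "range (\<lambda>_::nat. paths Y) \<subseteq> insert {} (cylinder Y ` lists Y)"
    using cylinder_Nil[of Y] by (auto intro!: image_eqI[of _ _ "[]"])
  interpret prob_space m using m by (simp add: borel_prob_on_paths_def)
  show "emeasure m (paths Y) \<noteq> \<infinity>" by simp
qed (use eq in auto)

lemma borel_prob_bernoulli:
  assumes Y: "finite Y" and p: "\<And>y. y \<in> Y \<Longrightarrow> 0 \<le> p y" "(\<Sum>y\<in>Y. p y) = 1"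
  shows "borel_prob_on_paths Y (bernoulli_measure Y p)"
proof -
  let ?N = "point_measure Y (\<lambda>y. ennreal (p y))"
  have "emeasure ?N (space ?N) = (\<Sum>y\<in>Y. ennreal (p y))"
    unfolding space_point_measure by (rule emeasure_point_measure_finite[OF Y]) simp
  also have "\<dots> = 1" using p by (simp add: sum_ennreal)
  finally have "prob_space ?N" by (rule prob_spaceI)
  then have "prob_space (bernoulli_measure Y p)"
    unfolding bernoulli_measure_def by (intro prob_space_PiM)
  moreover have "sets (bernoulli_measure Y p) = sets (path_borel Y)"
    unfolding bernoulli_measure_def sets_path_borel[OF Y]
    by (intro sets_PiM_cong) (simp_all add: sets_point_measure)
  ultimately show ?thesis by (simp add: borel_prob_on_paths_def)
qed

section \<open>Functionals on the Cuntz algebra\<close>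

locale cuntz_setting =
  fixes Y :: "'g set" and V :: "'g \<Rightarrow> 'a::cstar_algebra"
    and \<Gamma> :: "'a \<Rightarrow> (nat \<Rightarrow> 'g) \<Rightarrow> complex" and E :: "'a \<Rightarrow> 'a"
  assumes finite_Y: "finite Y" and Y_nonempty: "Y \<noteq> {}"
    and cuntz: "cuntz_algebra Y V"
    and diagonal_iso: "diagonal_iso Y V \<Gamma>"
    and diagonal_expectation: "diagonal_expectation Y V E"
begin

abbreviation W where "W \<equiv> word_isometry V"

abbreviation D where "D \<equiv> diagonal Y V"

lemma W_Nil [simp]: "W [] = 1"
  by (simp add: word_isometry_def)

lemma W_append: "W (t @ u) = W t * W u"
  by (simp add: word_isometry_def)

lemma star_W_W: "t \<in> lists Y \<Longrightarrow> star (W t) * W t = 1"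
proof (induction t)
  case (Cons s t)
  have "star (W (s # t)) * W (s # t) = star (W t) * (star (V s) * V s) * W t"
    by (simp add: word_isometry_def star_mult mult.assoc)
  also have "\<dots> = 1" using Cons cuntz by (simp add: cuntz_algebra_def)
  finally show ?case .
qed simp

lemma diagonal_star_subalgebra: "star_subalgebra D"
proof -
  have "star_subalgebra D \<and> closed D"
    unfolding diagonal_def cstar_generated_def
  proof (rule hull_in)
    fix T :: "'a set set"
    assume "\<forall>S\<in>T. star_subalgebra S \<and> closed S"
    then show "star_subalgebra (\<Inter>T) \<and> closed (\<Inter>T)"
      by (auto simp: star_subalgebra_def csubspace_def)
  qed
  then show ?thesis ..
qed

lemma diagonal_mult: "d \<in> D \<Longrightarrow> d' \<in> D \<Longrightarrow> d * d' \<in> D"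
  using diagonal_star_subalgebra by (auto simp: star_subalgebra_def)

lemma projection_in_diagonal: "t \<in> lists Y \<Longrightarrow> W t * star (W t) \<in> D"
  unfolding diagonal_def cstar_generated_def by (rule hull_inc) auto

lemma paths_nonempty: "paths Y \<noteq> {}"
  using Y_nonempty by (simp add: paths_eq PiE_eq_empty_iff)

lemma norm_diagonal: "d \<in> D \<Longrightarrow> norm d = (SUP x\<in>paths Y. cmod (\<Gamma> d x))"
  using diagonal_iso by (simp add: diagonal_iso_def)

lemma continuous_map_\<Gamma>: "d \<in> D \<Longrightarrow> continuous_map (path_topology Y) euclidean (\<Gamma> d)"
  using diagonal_iso by (simp add: diagonal_iso_def)

text \<open>A real supremum dominates its members only when the set is bounded above; compactness of
  the space of infinite words and continuity of \<open>\<Gamma> d\<close> provide this.\<close>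

lemma \<Gamma>_bound:
  assumes d: "d \<in> D" and x: "x \<in> paths Y"
  shows "cmod (\<Gamma> d x) \<le> norm d"
proof -
  have "compact_space (path_topology Y)"
    using finite_Y by (simp add: path_topology_def compact_space_product_topology
        compact_space_discrete_topology)
  then have "compactin euclidean (\<Gamma> d ` topspace (path_topology Y))"
    using image_compactin[OF _ continuous_map_\<Gamma>[OF d]] by (simp add: compact_space_def)
  then have "bounded (\<Gamma> d ` paths Y)"
    by (simp add: paths_def compact_imp_bounded)
  then have "bdd_above ((\<lambda>x. cmod (\<Gamma> d x)) ` paths Y)"
    by (auto simp: bounded_iff bdd_above_def)
  then show ?thesis
    unfolding norm_diagonal[OF d] using x by (intro cSUP_upper)
qed

lemma \<Gamma>_projection:
  "t \<in> lists Y \<Longrightarrow> x \<in> paths Y \<Longrightarrow> \<Gamma> (W t * star (W t)) x = indicator (cylinder Y t) x"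
  using diagonal_iso by (simp add: diagonal_iso_def)

lemma \<Gamma>_mult: "d \<in> D \<Longrightarrow> d' \<in> D \<Longrightarrow> x \<in> paths Y \<Longrightarrow> \<Gamma> (d * d') x = \<Gamma> d x * \<Gamma> d' x"
  and \<Gamma>_add: "d \<in> D \<Longrightarrow> d' \<in> D \<Longrightarrow> x \<in> paths Y \<Longrightarrow> \<Gamma> (d + d') x = \<Gamma> d x + \<Gamma> d' x"
  and \<Gamma>_scaleC: "d \<in> D \<Longrightarrow> x \<in> paths Y \<Longrightarrow> \<Gamma> (c *\<^sub>C d) x = c * \<Gamma> d x"
  using diagonal_iso by (simp_all add: diagonal_iso_def)

text \<open>Under \<Gamma> the two range projections become indicators with product 0, and \<Gamma>
  determines the norm on the diagonal, so the projections are orthogonal. Multiplying by the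
  isometries on both sides removes the outer factors.\<close>

lemma star_W_W_disjoint:
  assumes t: "t \<in> lists Y" and u: "u \<in> lists Y" and disj: "cylinder Y t \<inter> cylinder Y u = {}"
  shows "star (W t) * W u = 0"
proof -
  let ?P = "W t * star (W t)" and ?Q = "W u * star (W u)"
  have "norm (?P * ?Q) = (SUP x\<in>paths Y. cmod (\<Gamma> (?P * ?Q) x))"
    by (intro norm_diagonal diagonal_mult projection_in_diagonal t u)
  also have "\<dots> = (SUP x\<in>paths Y. 0)"
  proof (rule SUP_cong[OF refl])
    fix x assume x: "x \<in> paths Y"
    then have "\<Gamma> (?P * ?Q) x = indicator (cylinder Y t) x * indicator (cylinder Y u) x"
      using t u by (simp add: \<Gamma>_mult projection_in_diagonal \<Gamma>_projection)
    also have "\<dots> = 0" using disj by (auto simp: indicator_def)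
    finally show "cmod (\<Gamma> (?P * ?Q) x) = 0" by simp
  qed
  also have "\<dots> = 0" using paths_nonempty by simp
  finally have PQ: "?P * ?Q = 0" by simp
  have "star (W t) * W u = (star (W t) * W t) * (star (W t) * W u) * (star (W u) * W u)"
    using t u by (simp add: star_W_W)
  also have "\<dots> = star (W t) * (?P * ?Q) * W u" by (simp add: mult.assoc)
  finally show ?thesis by (simp add: PQ)
qed

lemma E_in_D: "E a \<in> D"
  and E_add: "E (a + b) = E a + E b"
  and E_scaleC: "E (c *\<^sub>C a) = c *\<^sub>C E a"
  and norm_E: "norm (E a) \<le> norm a"
  and E_bimodule: "d \<in> D \<Longrightarrow> d' \<in> D \<Longrightarrow> E (d * a * d') = d * E a * d'"
  using diagonal_expectation
  by (simp_all add: diagonal_expectation_def conditional_expectation_def clinear_op_def)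

text \<open>Evaluation at \<open>x\<close> after the conditional expectation. Bounds and positivity
  are proved for each \<open>x\<close> and integrated afterwards.\<close>

definition point_functional where "point_functional x a = \<Gamma> (E a) x"

context
  fixes x assumes x: "x \<in> paths Y"
begin

lemma point_functional_add:
  "point_functional x (a + b) = point_functional x a + point_functional x b"
  unfolding point_functional_def E_add
  by (rule \<Gamma>_add[OF E_in_D E_in_D x])

lemma point_functional_scaleC: "point_functional x (c *\<^sub>C a) = c * point_functional x a"
  unfolding point_functional_def E_scaleC
  by (rule \<Gamma>_scaleC[OF E_in_D x])

lemma point_functional_bound: "cmod (point_functional x a) \<le> norm a"
  unfolding point_functional_def using \<Gamma>_bound[OF E_in_D x] norm_E order_trans by blast

lemma point_functional_zero: "point_functional x 0 = 0"
  using point_functional_scaleC[of 0 0] by simp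

lemma point_functional_sum:
  "point_functional x (sum f I) = (\<Sum>i\<in>I. point_functional x (f i))"
  by (induction I rule: infinite_finite_induct)
     (auto simp: point_functional_zero point_functional_add)

lemma bounded_linear_point_functional: "bounded_linear (point_functional x)"
proof (rule bounded_linear_intro[where K=1])
  show "point_functional x (r *\<^sub>R a) = r *\<^sub>R point_functional x a" for r a
    using point_functional_scaleC[of "complex_of_real r" a]
    by (simp add: scaleC_of_real scaleR_conv_of_real)
qed (simp_all add: point_functional_add point_functional_bound)

lemma point_functional_W_star_W:
  assumes "t \<in> lists Y" "u \<in> lists Y"
  shows "point_functional x (W t * star (W u)) = (if t = u then indicator (cylinder Y t) x else 0)"
proof (cases "t = u")
  case True
  then show ?thesis
    using diagonal_expectation assms x
    by (simp add: point_functional_def diagonal_expectation_def \<Gamma>_projection)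
next
  case False
  then have "E (W t * star (W u)) = 0"
    using diagonal_expectation assms by (simp add: diagonal_expectation_def)
  then have "point_functional x (W t * star (W u)) = \<Gamma> (E 0) x"
    using E_scaleC[of 0 0] by (simp add: point_functional_def)
  then show ?thesis using False point_functional_zero by (simp add: point_functional_def)
qed

text \<open>If one of \<open>w\<close>, \<open>w'\<close> extends the other by \<open>y\<close>, the
  product collapses to \<open>W (v @ y) * star (W v)\<close> or its adjoint, and the expectation
  vanishes unless \<open>y\<close> is empty. Thus words form an orthonormal family for the
  compressed functional.\<close>

lemma point_functional_sandwich:
  assumes v: "v \<in> lists Y" "x \<in> cylinder Y v" and w: "w \<in> lists Y" "w' \<in> lists Y"
  shows "point_functional x (W v * star (W w) * W w' * star (W v)) = (if w = w' then 1 else 0)"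
  using w
proof (cases rule: cylinder_append_disjoint_cases)
  case (left y)
  have "W v * star (W w) * W w' * star (W v) = W v * (star (W w) * W w) * W y * star (W v)"
    by (simp add: left W_append mult.assoc)
  also have "\<dots> = W (v @ y) * star (W v)" using w by (simp add: star_W_W W_append)
  finally show ?thesis using left v by (simp add: point_functional_W_star_W)
next
  case (right y)
  have "W v * star (W w) * W w' * star (W v) = W v * star (W y) * (star (W w') * W w') * star (W v)"
    by (simp add: right W_append star_mult mult.assoc)
  also have "\<dots> = W v * star (W (v @ y))" using w by (simp add: star_W_W W_append star_mult mult.assoc)
  finally show ?thesis using right v by (simp add: point_functional_W_star_W)
next
  case disjoint
  then have "w \<noteq> w'" using cylinder_nonempty[OF Y_nonempty w(1)] by auto
  moreover have "W v * star (W w) * W w' * star (W v) = W v * (star (W w) * W w') * star (W v)"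
    by (simp add: mult.assoc)
  then have "W v * star (W w) * W w' * star (W v) = 0"
    by (simp add: star_W_W_disjoint[OF w disjoint])
  ultimately show ?thesis by (simp add: point_functional_zero)
qed

end

end

section \<open>Positivity of point evaluations and states from measures\<close>

context cuntz_setting begin

abbreviation algebraic_span where
  "algebraic_span \<equiv> csubspace hull {W t * star (W u) |t u. t \<in> lists Y \<and> u \<in> lists Y}"

text \<open>Once \<open>N\<close> reaches the length of \<open>u\<close>, the product of
  \<open>star (W u)\<close> with the prefix of \<open>x\<close> is a word isometry or 0, so no
  adjoint is left. The claim is made for all large \<open>N\<close> so that two summands share a
  threshold.\<close>

lemma algebraic_span_mult_W:
  assumes a: "a \<in> algebraic_span" and x: "x \<in> paths Y"
  shows "\<exists>N0. \<forall>N\<ge>N0. a * W (map x [0..<N]) \<in> csubspace hull (W ` lists Y)"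
proof -
  let ?H = "csubspace hull (W ` lists Y)"
  let ?S = "{a. \<exists>N0. \<forall>N\<ge>N0. a * W (map x [0..<N]) \<in> ?H}"
  have H: "csubspace ?H" by (rule csubspace_hull)
  have v: "map x [0..<N] \<in> lists Y" for N
    using x by (auto simp: paths_eq PiE_iff)
  have "csubspace ?S"
    unfolding csubspace_def[of ?S]
  proof (intro conjI ballI allI)
    show "0 \<in> ?S" using H by (simp add: csubspace_def)
  next
    fix a b assume "a \<in> ?S" "b \<in> ?S"
    then obtain M N where M: "\<And>n. n \<ge> M \<Longrightarrow> a * W (map x [0..<n]) \<in> ?H"
      and N: "\<And>n. n \<ge> N \<Longrightarrow> b * W (map x [0..<n]) \<in> ?H" by auto
    have "(a + b) * W (map x [0..<n]) \<in> ?H" if "n \<ge> max M N" for n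
      using M[of n] N[of n] that H by (simp add: distrib_right csubspace_def)
    then show "a + b \<in> ?S" by blast
  next
    fix c a assume "a \<in> ?S"
    then obtain N where N: "\<And>n. n \<ge> N \<Longrightarrow> a * W (map x [0..<n]) \<in> ?H" by auto
    have "c *\<^sub>C a * W (map x [0..<n]) \<in> ?H" if "n \<ge> N" for n
      using N[of n] that H by (simp add: scaleC_mult_left csubspace_def)
    then show "c *\<^sub>C a \<in> ?S" by blast
  qed
  moreover have "W t * star (W u) \<in> ?S" if t: "t \<in> lists Y" and u: "u \<in> lists Y" for t u
  proof -
    have "W t * star (W u) * W (map x [0..<N]) \<in> ?H" if N: "N \<ge> length u" for N
      using u v[of N]
    proof (cases rule: cylinder_append_disjoint_cases)
      case (left y)
      have "W t * star (W u) * W (map x [0..<N]) = W t * (star (W u) * W u) * W y"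
        by (simp add: left W_append mult.assoc)
      also have "\<dots> = W (t @ y)" by (simp add: star_W_W u W_append)
      also have "\<dots> \<in> ?H" by (rule hull_inc) (use t left in auto)
      finally show ?thesis .
    next
      case (right y)
      from arg_cong[OF right(2), of length] N have "y = []" by simp
      then have "W t * star (W u) * W (map x [0..<N]) = W t"
        using right v[of N] by (simp add: mult.assoc star_W_W)
      also have "\<dots> \<in> ?H" by (rule hull_inc) (use t in auto)
      finally show ?thesis .
    next
      case disjoint
      then have "W t * star (W u) * W (map x [0..<N]) = 0"
        by (simp add: mult.assoc star_W_W_disjoint u v)
      then show ?thesis using H by (simp add: csubspace_def)
    qed
    then show ?thesis by blast
  qed
  ultimately have "algebraic_span \<subseteq> ?S"
    by (intro hull_minimal) blast+
  then show ?thesis using a by blast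
qed

text \<open>Compressing \<open>a\<close> to a small cylinder around \<open>x\<close> turns it into \<open>p * star v\<close> with \<open>p\<close> a
  combination of words, for which \<open>star p * p\<close> has an evident sum of squares on the diagonal.
  The positivity of \<open>E\<close> is of no use here: it provides a square root outside of the diagonal.\<close>

lemma point_functional_positive_span:
  assumes a: "a \<in> algebraic_span" and x: "x \<in> paths Y"
  shows "point_functional x (star a * a) \<in> \<real>\<^sub>\<ge>\<^sub>0"
proof -
  obtain N where "a * W (map x [0..<N]) \<in> csubspace hull (W ` lists Y)"
    using algebraic_span_mult_W[OF a x] by blast
  then obtain S c where S: "finite S" "S \<subseteq> lists Y"
    and p: "a * W (map x [0..<N]) = (\<Sum>w\<in>S. c w *\<^sub>C W w)"
    by (rule csubspace_hull_image_explicit)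
  define v where "v = map x [0..<N]"
  have v: "v \<in> lists Y" "x \<in> cylinder Y v"
    using x by (auto simp: v_def cylinder_def paths_eq PiE_iff)
  let ?Q = "W v * star (W v)"
  have Q: "?Q \<in> D" by (rule projection_in_diagonal[OF v(1)])
  have Qx: "\<Gamma> ?Q x = 1" using v x by (simp add: \<Gamma>_projection)
  \<comment> \<open>Since \<open>\<Gamma> ?Q x = 1\<close>, the factors \<open>?Q\<close> leave the
    value at \<open>x\<close> unchanged, and the bimodule property then moves them inside
    \<open>E\<close>.\<close>
  have "point_functional x (star a * a) = \<Gamma> (?Q * E (star a * a) * ?Q) x"
    using Q Qx x by (simp add: point_functional_def \<Gamma>_mult diagonal_mult E_in_D)
  also have "\<dots> = point_functional x (?Q * (star a * a) * ?Q)"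
    by (simp only: point_functional_def E_bimodule[OF Q Q])
  also have "?Q * (star a * a) * ?Q = W v * (star (a * W v) * (a * W v)) * star (W v)"
    by (simp add: star_mult mult.assoc)
  also have "star (a * W v) * (a * W v) = (\<Sum>w\<in>S. \<Sum>w'\<in>S. (cnj (c w) * c w') *\<^sub>C (star (W w) * W w'))"
    unfolding v_def p
    by (simp add: star_sum star_scaleC sum_product scaleC_mult_left scaleC_mult_right scaleC_scaleC
        mult.commute)
  also have "W v * \<dots> * star (W v) =
      (\<Sum>w\<in>S. \<Sum>w'\<in>S. (cnj (c w) * c w') *\<^sub>C (W v * star (W w) * W w' * star (W v)))"
    by (simp add: sum_distrib_left sum_distrib_right scaleC_mult_left scaleC_mult_right mult.assoc)
  also have "point_functional x \<dots> = (\<Sum>w\<in>S. \<Sum>w'\<in>S. (cnj (c w) * c w') * (if w = w' then 1 else 0))"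
    unfolding point_functional_sum[OF x] point_functional_scaleC[OF x]
    by (intro sum.cong refl arg_cong2[of _ _ _ _ "(*)"] point_functional_sandwich x v) (use S in auto)
  also have "\<dots> = (\<Sum>w\<in>S. of_real ((cmod (c w))\<^sup>2))"
    by (intro sum.cong refl) (simp add: S(1) if_distrib sum.delta mult.commute complex_norm_square
        cong: if_cong del: of_real_power)
  also have "\<dots> = of_real (\<Sum>w\<in>S. (cmod (c w))\<^sup>2)" by simp
  also have "\<dots> \<in> \<real>\<^sub>\<ge>\<^sub>0" by (simp add: sum_nonneg nonneg_Reals_of_real_iff del: of_real_sum of_real_power)
  finally show ?thesis .
qed

lemma point_functional_positive:
  assumes a: "a \<in> closure algebraic_span" and x: "x \<in> paths Y"
  shows "point_functional x (star a * a) \<in> \<real>\<^sub>\<ge>\<^sub>0"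
proof -
  obtain f where f: "\<And>n. f n \<in> algebraic_span" "f \<longlonglongrightarrow> a"
    using a unfolding closure_sequential by blast
  have "(\<lambda>n. point_functional x (star (f n) * f n)) \<longlonglongrightarrow> point_functional x (star a * a)"
    by (intro bounded_linear.tendsto[OF bounded_linear_point_functional[OF x]] tendsto_mult f(2)
        bounded_linear.tendsto[OF bounded_linear_star])
  then show ?thesis
    by (rule closed_sequentially[OF closed_nonneg_Reals_complex, rotated])
       (rule point_functional_positive_span[OF f(1) x])
qed

definition measure_functional where
  "measure_functional m a = (LINT x|m. point_functional x a)"

context
  fixes m assumes m: "borel_prob_on_paths Y m"
begin

interpretation prob_space m
  using m by (simp add: borel_prob_on_paths_def)

lemma space_borel_prob_on_paths: "space m = paths Y"
proof -
  have "space m = space (path_borel Y)"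
    using m by (intro sets_eq_imp_space_eq) (simp add: borel_prob_on_paths_def)
  also have "\<dots> = paths Y" unfolding path_borel_def paths_def
    by (rule space_measure_of) (auto dest: openin_subset)
  finally show ?thesis .
qed

lemma openin_path_topology_sets: "openin (path_topology Y) U \<Longrightarrow> U \<in> sets m"
proof -
  have "{U. openin (path_topology Y) U} \<subseteq> Pow (paths Y)"
    by (auto simp: paths_def dest: openin_subset)
  then show "openin (path_topology Y) U \<Longrightarrow> U \<in> sets m"
    using m by (auto simp: borel_prob_on_paths_def path_borel_def sets_measure_of)
qed

lemma measurable_\<Gamma>: "d \<in> D \<Longrightarrow> \<Gamma> d \<in> borel_measurable m"
proof (rule borel_measurableI)
  fix S :: "complex set" assume "open S" "d \<in> D"
  then have "openin (path_topology Y) {x \<in> topspace (path_topology Y). \<Gamma> d x \<in> S}"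
    by (intro openin_continuous_map_preimage[OF continuous_map_\<Gamma>]) auto
  also have "{x \<in> topspace (path_topology Y). \<Gamma> d x \<in> S} = \<Gamma> d -` S \<inter> space m"
    by (auto simp: space_borel_prob_on_paths paths_def)
  finally show "\<Gamma> d -` S \<inter> space m \<in> sets m" by (rule openin_path_topology_sets)
qed

lemma measurable_point_functional: "(\<lambda>x. point_functional x a) \<in> borel_measurable m"
  using measurable_\<Gamma>[OF E_in_D] by (simp add: point_functional_def)

lemma cylinder_in_sets: "t \<in> lists Y \<Longrightarrow> cylinder Y t \<in> sets m"
  using m sets_path_borel_eq_sigma_cylinders[OF finite_Y]
  by (auto simp: borel_prob_on_paths_def intro: sigma_sets.Basic)

lemma integrable_point_functional: "integrable m (\<lambda>x. point_functional x a)"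
  by (rule integrable_const_bound[where B="norm a"])
     (auto intro!: AE_I2 point_functional_bound measurable_point_functional
        simp: space_borel_prob_on_paths)

lemma measure_functional_add:
  "measure_functional m (a + b) = measure_functional m a + measure_functional m b"
proof -
  have "measure_functional m (a + b) = (LINT x|m. point_functional x a + point_functional x b)"
    unfolding measure_functional_def
    by (intro Bochner_Integration.integral_cong)
       (auto simp: space_borel_prob_on_paths point_functional_add)
  then show ?thesis by (simp add: measure_functional_def integrable_point_functional)
qed

lemma measure_functional_scaleC:
  "measure_functional m (c *\<^sub>C a) = c * measure_functional m a"
proof -
  have "measure_functional m (c *\<^sub>C a) = (LINT x|m. c * point_functional x a)"
    unfolding measure_functional_def
    by (intro Bochner_Integration.integral_cong)
       (auto simp: space_borel_prob_on_paths point_functional_scaleC)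
  then show ?thesis by (simp add: measure_functional_def)
qed

text \<open>The strip argument needs this on the whole ambient algebra; it follows from the
  pointwise bound because \<open>m\<close> has mass 1.\<close>

lemma measure_functional_bound: "cmod (measure_functional m a) \<le> norm a"
proof -
  have "cmod (measure_functional m a) \<le> (LINT x|m. cmod (point_functional x a))"
    unfolding measure_functional_def by (rule integral_norm_bound)
  also have "\<dots> \<le> (LINT x|m. norm a)"
    by (intro integral_mono integrable_norm integrable_point_functional)
       (auto simp: space_borel_prob_on_paths point_functional_bound)
  finally show ?thesis by (simp add: prob_space)
qed

lemma measure_functional_W_star_W:
  assumes "t \<in> lists Y" "u \<in> lists Y"
  shows "measure_functional m (W t * star (W u)) =
    (if t = u then complex_of_real (measure m (cylinder Y t)) else 0)"
proof -
  have "measure_functional m (W t * star (W u)) =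
      (LINT x|m. (if t = u then indicator (cylinder Y t) x else 0))"
    unfolding measure_functional_def
    by (intro Bochner_Integration.integral_cong)
       (auto simp: space_borel_prob_on_paths point_functional_W_star_W assms)
  also have "\<dots> = (if t = u then complex_of_real (measure m (cylinder Y t)) else 0)"
  proof -
    have "(LINT x|m. indicator (cylinder Y t) x :: complex) =
        (LINT x|m. complex_of_real (indicator (cylinder Y t) x))"
      by (intro Bochner_Integration.integral_cong) (auto simp: indicator_def)
    also have "\<dots> = complex_of_real (measure m (cylinder Y t))"
      using cylinder_in_sets[OF assms(1)] by (subst integral_complex_of_real) simp
    finally show ?thesis by (cases "t = u") simp_all
  qed
  finally show ?thesis .
qed

lemma measure_functional_positive:
  assumes "a \<in> closure algebraic_span"
  shows "measure_functional m (star a * a) \<in> \<real>\<^sub>\<ge>\<^sub>0"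
proof -
  let ?f = "\<lambda>x. point_functional x (star a * a)"
  have f: "?f x = complex_of_real (Re (?f x))" "0 \<le> Re (?f x)" if "x \<in> space m" for x
    using point_functional_positive[OF assms, of x] that
    by (auto simp: space_borel_prob_on_paths complex_nonneg_Reals_iff complex_eq_iff)
  have "measure_functional m (star a * a) = (LINT x|m. complex_of_real (Re (?f x)))"
    unfolding measure_functional_def by (intro Bochner_Integration.integral_cong refl f(1))
  also have "\<dots> = complex_of_real (LINT x|m. Re (?f x))"
    by (rule integral_complex_of_real)
  also have "\<dots> \<in> \<real>\<^sub>\<ge>\<^sub>0"
    by (simp add: f(2) Bochner_Integration.integral_nonneg)
  finally show ?thesis .
qed

lemma state_on_measure_functional:
  assumes "B \<subseteq> closure algebraic_span"
  shows "state_on B (measure_functional m)"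
proof -
  have "paths Y = cylinder Y []" by (auto simp: cylinder_def)
  then have "measure_functional m 1 = 1"
    using measure_functional_W_star_W[of "[]" "[]"] prob_space space_borel_prob_on_paths by simp
  then show ?thesis
    using assms by (auto simp: state_on_def measure_functional_add measure_functional_scaleC
        intro!: measure_functional_positive)
qed

end

end

section \<open>Harmonic functions on groups with finite abelianization\<close>

lemma (in group) word_eval_closed: "Y \<subseteq> carrier G \<Longrightarrow> t \<in> lists Y \<Longrightarrow> word_eval G t \<in> carrier G"
  by (induction t) (auto simp: word_eval_def)

lemma (in group) word_eval_append:
  assumes "Y \<subseteq> carrier G" "t \<in> lists Y" "u \<in> lists Y"
  shows "word_eval G (t @ u) = word_eval G t \<otimes> word_eval G u"
  using assms(2)
proof (induction t)
  case Nil
  then show ?case using word_eval_closed[OF assms(1,3)] by (simp add: word_eval_def)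
next
  case (Cons s t)
  then have "s \<in> carrier G" "word_eval G t \<in> carrier G" "word_eval G u \<in> carrier G"
    using assms(1) word_eval_closed[OF assms(1)] assms(3) by auto
  then show ?case using Cons by (simp add: word_eval_def m_assoc)
qed

lemma word_weight_append: "word_weight F (t @ u) = word_weight F t + word_weight F u"
  by (simp add: word_weight_def)

text \<open>Every \<open>h\<close> is reached from an arbitrary start \<open>g\<close> by right
  multiplication with letters, because \<open>inv g \<otimes> h\<close> is itself a product of
  letters.\<close>

lemma (in group) generates_as_semigroup_induct:
  assumes Y: "Y \<subseteq> carrier G" and gen: "generates_as_semigroup G Y"
    and g: "g \<in> carrier G" "P g"
    and step: "\<And>h s. h \<in> carrier G \<Longrightarrow> s \<in> Y \<Longrightarrow> P h \<Longrightarrow> P (h \<otimes> s)"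
    and h: "h \<in> carrier G"
  shows "P h"
proof -
  have walk: "w \<in> lists Y \<Longrightarrow> k \<in> carrier G \<Longrightarrow> P k \<Longrightarrow> P (k \<otimes> word_eval G w)" for w k
  proof (induction w arbitrary: k)
    case (Cons s w)
    then have "s \<in> carrier G" "word_eval G w \<in> carrier G"
      using Y word_eval_closed[OF Y] by auto
    then have "k \<otimes> word_eval G (s # w) = (k \<otimes> s) \<otimes> word_eval G w"
      using Cons.prems by (simp add: word_eval_def m_assoc)
    moreover have "P ((k \<otimes> s) \<otimes> word_eval G w)"
      using Cons step \<open>s \<in> carrier G\<close> by auto
    ultimately show ?case by simp
  qed (simp add: word_eval_def)
  have "inv g \<otimes> h \<in> carrier G" using g h by simp
  then obtain w where w: "w \<in> lists Y" "inv g \<otimes> h = word_eval G w"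
    using gen unfolding generates_as_semigroup_def by auto
  have "h = g \<otimes> word_eval G w" using g h by (simp flip: w(2) add: m_assoc[symmetric])
  then show ?thesis using walk[OF w(1) g] by simp
qed

text \<open>Two exchanges cancel a commutator behind the prefix \<open>g\<close>: first
  \<open>a\<close> moves past \<open>b \<otimes> inv a \<otimes> inv b\<close>, then
  \<open>inv a\<close> moves past \<open>inv b \<otimes> a\<close>. The induction over
  \<open>generate\<close> keeps \<open>g\<close> arbitrary because a product shifts the base
  point.\<close>

lemma (in group) derived_right_invariant:
  assumes comm: "\<And>x y z. x \<in> carrier G \<Longrightarrow> y \<in> carrier G \<Longrightarrow> z \<in> carrier G \<Longrightarrow>
      f (x \<otimes> y \<otimes> z) = f (x \<otimes> z \<otimes> y)"
    and h: "h \<in> derived G (carrier G)" and g: "g \<in> carrier G"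
  shows "f (g \<otimes> h) = f g"
proof -
  have commutator: "f (g \<otimes> h) = f g" if g: "g \<in> carrier G" and h: "h \<in> derived_set G (carrier G)" for g h
  proof -
    obtain a b where ab: "a \<in> carrier G" "b \<in> carrier G" "h = a \<otimes> b \<otimes> inv a \<otimes> inv b"
      using h by auto
    have "f (g \<otimes> h) = f (g \<otimes> a \<otimes> (b \<otimes> inv a \<otimes> inv b))" using g ab by (simp add: m_assoc)
    also have "\<dots> = f (g \<otimes> (b \<otimes> inv a \<otimes> inv b) \<otimes> a)" using g ab by (intro comm) auto
    also have "\<dots> = f (g \<otimes> b \<otimes> inv a \<otimes> (inv b \<otimes> a))" using g ab by (simp add: m_assoc)
    also have "\<dots> = f (g \<otimes> b \<otimes> (inv b \<otimes> a) \<otimes> inv a)" using g ab by (intro comm) auto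
    also have "g \<otimes> b \<otimes> (inv b \<otimes> a) \<otimes> inv a = g \<otimes> (b \<otimes> inv b) \<otimes> (a \<otimes> inv a)"
      using g ab by (simp only: m_assoc m_closed inv_closed)
    also have "\<dots> = g" using g ab by simp
    finally show ?thesis .
  qed
  have sub: "derived_set G (carrier G) \<subseteq> carrier G" by (rule derived_set_in_carrier) simp
  have "h \<in> generate G (derived_set G (carrier G))" using h by (simp add: derived_def)
  then show ?thesis using g
  proof (induction arbitrary: g rule: generate.induct)
    case (inv h)
    then have hc: "h \<in> carrier G" using sub by blast
    \<comment> \<open>The commutator case is used at the base point
      \<open>g \<otimes> inv h\<close>.\<close>
    have "f (g \<otimes> inv h) = f (g \<otimes> inv h \<otimes> h)" using inv hc by (intro commutator[symmetric]) auto
    then show ?case using inv hc by (simp add: m_assoc)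
  next
    case (eng h1 h2)
    have c: "h1 \<in> carrier G" "h2 \<in> carrier G"
      using generate_in_carrier[OF sub eng.hyps(1)] generate_in_carrier[OF sub eng.hyps(2)] .
    have "f (g \<otimes> (h1 \<otimes> h2)) = f ((g \<otimes> h1) \<otimes> h2)" using c eng.prems by (simp add: m_assoc)
    also have "\<dots> = f g" using c eng.prems by (simp add: eng.IH)
    finally show ?case .
  qed (auto intro: commutator)
qed

lemma (in group) finite_range_if_commuting:
  assumes comm: "\<And>x y z. x \<in> carrier G \<Longrightarrow> y \<in> carrier G \<Longrightarrow> z \<in> carrier G \<Longrightarrow>
      f (x \<otimes> y \<otimes> z) = f (x \<otimes> z \<otimes> y)"
    and fin: "finite (carrier (G Mod derived G (carrier G)))"
  shows "finite (f ` carrier G)"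
proof -
  let ?N = "derived G (carrier G)"
  have N: "subgroup ?N G" by (rule derived_is_subgroup) simp
  have eq: "f g = f g'" if g: "g \<in> carrier G" and g': "g' \<in> carrier G" and c: "?N #> g = ?N #> g'" for g g'
  proof -
    have "g \<in> ?N #> g'" using rcos_self[OF g N] c by simp
    then obtain n where n: "n \<in> ?N" "g = n \<otimes> g'" by (auto simp: r_coset_def)
    have nc: "n \<in> carrier G" using n(1) subgroup.subset[OF N] by blast
    \<comment> \<open>In the coset, \<open>n\<close> stands on the left of \<open>g'\<close>;
      \<open>comm\<close> with first factor \<one> brings it to the right, where invariance is
      known.\<close>
    have "f g = f (g' \<otimes> n)" using comm[OF one_closed nc g'] nc g' n(2) by simp
    then show ?thesis using derived_right_invariant[of f n g', OF comm n(1) g'] by simp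
  qed
  have "carrier (G Mod ?N) = (\<lambda>g. ?N #> g) ` carrier G"
    by (auto simp: FactGroup_def RCOSETS_def)
  then have "finite ((\<lambda>g. ?N #> g) ` carrier G)" using fin by simp
  moreover have "f ` carrier G \<subseteq> (\<lambda>c. f (SOME g. g \<in> carrier G \<and> ?N #> g = c)) ` (\<lambda>g. ?N #> g) ` carrier G"
  proof
    fix y assume "y \<in> f ` carrier G"
    then obtain g where g: "g \<in> carrier G" "y = f g" by auto
    let ?g = "SOME g'. g' \<in> carrier G \<and> ?N #> g' = ?N #> g"
    have "?g \<in> carrier G \<and> ?N #> ?g = ?N #> g"
      by (rule someI[of _ g]) (simp add: g)
    then have "y = f ?g" using eq[of ?g g] g by simp
    then show "y \<in> (\<lambda>c. f (SOME g. g \<in> carrier G \<and> ?N #> g = c)) ` (\<lambda>g. ?N #> g) ` carrier G"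
      using g by blast
  qed
  ultimately show ?thesis by (meson finite_imageI finite_subset)
qed

text \<open>Comparing the value at a maximum and at a minimum of \<open>f\<close> with the mean over the neighbours
  gives \<open>sum p Y = 1\<close>; the maximum principle then makes \<open>f\<close> constant.\<close>

lemma (in group) harmonic_finite_range_constant:
  fixes f :: "'a \<Rightarrow> real"
  assumes Y: "Y \<subseteq> carrier G" "finite Y" and gen: "generates_as_semigroup G Y"
    and p: "\<And>s. s \<in> Y \<Longrightarrow> p s > 0"
    and harmonic: "\<And>g. g \<in> carrier G \<Longrightarrow> f g = (\<Sum>s\<in>Y. p s * f (g \<otimes> s))"
    and nonneg: "\<And>g. g \<in> carrier G \<Longrightarrow> f g \<ge> 0" and one: "f \<one> = 1"
    and fin: "finite (f ` carrier G)"
  shows "sum p Y = 1" and "g \<in> carrier G \<Longrightarrow> f g = 1"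
proof -
  have ne: "f ` carrier G \<noteq> {}" by auto
  obtain a where a: "a \<in> carrier G" "f a = Max (f ` carrier G)"
    using Max_in[OF fin ne] by (metis imageE)
  obtain b where b: "b \<in> carrier G" "f b = Min (f ` carrier G)"
    using Min_in[OF fin ne] by (metis imageE)
  have le: "f g \<le> f a" "f b \<le> f g" if "g \<in> carrier G" for g
    using that fin a b by auto
  have mult_Y: "g \<otimes> s \<in> carrier G" if "g \<in> carrier G" "s \<in> Y" for g s
    using that Y by auto
  have "f a > 0" using le(1)[OF one_closed] one by simp
  have "f a = (\<Sum>s\<in>Y. p s * f (a \<otimes> s))" by (rule harmonic[OF a(1)])
  also have "\<dots> \<le> (\<Sum>s\<in>Y. p s * f a)"
    by (intro sum_mono mult_left_mono le mult_Y a less_imp_le[OF p])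
  finally have ge1: "sum p Y \<ge> 1" using \<open>f a > 0\<close> by (simp flip: sum_distrib_right)
  \<comment> \<open>A zero of a nonnegative harmonic function passes to all right neighbours, hence
    to \<one>, where the value is 1. Positivity permits the division by \<open>f b\<close>
    below.\<close>
  have "f b > 0"
  proof (rule ccontr)
    assume "\<not> f b > 0"
    then have "f b = 0" using nonneg[OF b(1)] by simp
    have "f \<one> = 0"
    proof (rule generates_as_semigroup_induct[where P = "\<lambda>h. f h = 0", OF Y(1) gen b(1) \<open>f b = 0\<close> _ one_closed])
      fix h s assume h: "h \<in> carrier G" "s \<in> Y" "f h = 0"
      then have "(\<Sum>s\<in>Y. p s * f (h \<otimes> s)) = 0" using harmonic by simp
      moreover have "0 \<le> p s * f (h \<otimes> s)" if "s \<in> Y" for s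
        by (intro mult_nonneg_nonneg less_imp_le[OF p] nonneg mult_Y h that)
      ultimately have "p s * f (h \<otimes> s) = 0"
        using sum_nonneg_eq_0_iff[OF Y(2), of "\<lambda>s. p s * f (h \<otimes> s)"] h(2) by blast
      then show "f (h \<otimes> s) = 0" using p[OF h(2)] by simp
    qed
    then show False using one by simp
  qed
  have "(\<Sum>s\<in>Y. p s * f b) \<le> (\<Sum>s\<in>Y. p s * f (b \<otimes> s))"
    by (intro sum_mono mult_left_mono le mult_Y b less_imp_le[OF p])
  also have "\<dots> = f b" by (rule harmonic[OF b(1), symmetric])
  finally have le1: "sum p Y \<le> 1" using \<open>f b > 0\<close> by (simp flip: sum_distrib_right)
  show sum: "sum p Y = 1" using ge1 le1 by simp
  have const: "f h = f a" if h: "h \<in> carrier G" for h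
  proof (rule generates_as_semigroup_induct[where P = "\<lambda>h. f h = f a", OF Y(1) gen a(1) refl _ h])
    fix k s assume k: "k \<in> carrier G" "s \<in> Y" "f k = f a"
    have "(\<Sum>s\<in>Y. p s * (f a - f (k \<otimes> s))) = sum p Y * f a - f k"
      by (simp add: harmonic[OF k(1)] right_diff_distrib sum_subtractf sum_distrib_right)
    also have "\<dots> = 0" using k sum by simp
    finally have "(\<Sum>s\<in>Y. p s * (f a - f (k \<otimes> s))) = 0" .
    moreover have "0 \<le> p s * (f a - f (k \<otimes> s))" if "s \<in> Y" for s
      using le(1)[OF mult_Y[OF k(1) that]] p[OF that] by (simp add: less_imp_le)
    ultimately have "p s * (f a - f (k \<otimes> s)) = 0"
      using sum_nonneg_eq_0_iff[OF Y(2), of "\<lambda>s. p s * (f a - f (k \<otimes> s))"] k(2) by blast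
    then show "f (k \<otimes> s) = f a" using p[OF k(2)] by simp
  qed
  show "f g = 1" if "g \<in> carrier G" using const[OF that] const[OF one_closed] one by simp
qed

section \<open>KMS measures\<close>

locale cuntz_flow = cuntz_setting Y V \<Gamma> E + group G
  for Y :: "'g set" and V :: "'g \<Rightarrow> 'a::cstar_algebra"
    and \<Gamma> :: "'a \<Rightarrow> (nat \<Rightarrow> 'g) \<Rightarrow> complex" and E :: "'a \<Rightarrow> 'a"
    and G :: "('g, 'm) monoid_scheme" (structure) +
  fixes F :: "'g \<Rightarrow> real" and \<alpha> :: "real \<Rightarrow> 'a \<Rightarrow> 'a"
  assumes Y_subset: "Y \<subseteq> carrier G" and gauge_flow: "gauge_flow Y V F \<alpha>"
begin

section \<open>The dense invariant algebra spanned by the generators\<close>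

abbreviation B where "B \<equiv> O_Y_G G Y V"

abbreviation generators where
  "generators \<equiv> {W t * star (W u) |t u. t \<in> lists Y \<and> u \<in> lists Y \<and> word_eval G t = word_eval G u}"

abbreviation A where "A \<equiv> csubspace hull generators"

lemma B_eq: "B = closure A"
  by (simp add: O_Y_G_def closed_cspan_def)

lemma B_subset: "B \<subseteq> closure algebraic_span"
  unfolding B_eq by (intro closure_mono hull_mono) blast

lemma generator_in_A:
  "t \<in> lists Y \<Longrightarrow> u \<in> lists Y \<Longrightarrow> word_eval G t = word_eval G u \<Longrightarrow> W t * star (W u) \<in> A"
  by (rule hull_inc) blast

lemma A_subset_B: "A \<subseteq> B"
  unfolding B_eq by (rule closure_subset)

text \<open>The surplus tail \<open>y\<close> is appended to a word on the opposite side. Since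
  \<open>word_eval\<close> is multiplicative, the group values remain equal.\<close>

lemma generator_mult:
  assumes t: "t \<in> lists Y" and u: "u \<in> lists Y" and tu: "word_eval G t = word_eval G u"
    and s: "s \<in> lists Y" and r: "r \<in> lists Y" and sr: "word_eval G s = word_eval G r"
  shows "W t * star (W u) * (W s * star (W r)) \<in> A"
  using u s
proof (cases rule: cylinder_append_disjoint_cases)
  case (left y)
  have "W t * star (W u) * (W s * star (W r)) = W t * (star (W u) * W u) * W y * star (W r)"
    by (simp add: left W_append mult.assoc)
  also have "\<dots> = W (t @ y) * star (W r)" by (simp add: star_W_W u W_append)
  also have "\<dots> \<in> A"
    using left t u r tu sr by (intro generator_in_A) (auto simp: word_eval_append[OF Y_subset])
  finally show ?thesis .
next
  case (right y)
  have "W t * star (W u) * (W s * star (W r)) = W t * star (W y) * (star (W s) * W s) * star (W r)"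
    by (simp add: right W_append star_mult mult.assoc)
  also have "\<dots> = W t * star (W (r @ y))" by (simp add: star_W_W s W_append star_mult mult.assoc)
  also have "\<dots> \<in> A"
    using right t s r tu sr by (intro generator_in_A) (auto simp: word_eval_append[OF Y_subset])
  finally show ?thesis .
next
  case disjoint
  have "W t * star (W u) * (W s * star (W r)) = W t * (star (W u) * W s) * star (W r)"
    by (simp add: mult.assoc)
  then have "W t * star (W u) * (W s * star (W r)) = 0"
    by (simp add: star_W_W_disjoint[OF u s disjoint])
  then show ?thesis using csubspace_hull[of generators] by (simp add: csubspace_def[of A])
qed

lemma star_subalgebra_A: "star_subalgebra A"
  unfolding star_subalgebra_def
proof (intro conjI ballI csubspace_hull)
  fix a b assume a: "a \<in> A" and b: "b \<in> A"
  have "x * y \<in> A" if x: "x \<in> generators" and y: "y \<in> generators" for x y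
  proof -
    obtain t u where "x = W t * star (W u)" "t \<in> lists Y" "u \<in> lists Y" "word_eval G t = word_eval G u"
      using x by blast
    moreover obtain s r where "y = W s * star (W r)" "s \<in> lists Y" "r \<in> lists Y" "word_eval G s = word_eval G r"
      using y by blast
    ultimately show ?thesis by (simp only: generator_mult)
  qed
  from csubspace_hull_mult[OF this a b] show "a * b \<in> A" .
next
  fix a assume a: "a \<in> A"
  have "star x \<in> generators" if x: "x \<in> generators" for x
  proof -
    obtain t u where "x = W t * star (W u)" "t \<in> lists Y" "u \<in> lists Y" "word_eval G t = word_eval G u"
      using x by blast
    then have "star x = W u * star (W t)" "u \<in> lists Y" "t \<in> lists Y" "word_eval G u = word_eval G t"
      by (simp_all add: star_mult star_star)
    then show ?thesis by blast
  qed
  from csubspace_hull_star[OF this a] show "star a \<in> A" .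
qed

lemma flow_generator:
  assumes "t \<in> lists Y" "u \<in> lists Y"
  shows "\<alpha> r (W t * star (W u)) =
    exp (\<i> * complex_of_real (r * (word_weight F t - word_weight F u))) *\<^sub>C (W t * star (W u))"
  using gauge_flow assms by (simp add: gauge_flow_def)

lemma one_parameter_group_flow: "one_parameter_group \<alpha>"
  using gauge_flow by (simp add: gauge_flow_def)

lemma flow_linear: "clinear_op (\<alpha> r)"
  using one_parameter_group_flow by (simp add: one_parameter_group_def star_automorphism_def)

lemma flow_invariant_A: "\<alpha> r ` A \<subseteq> A"
proof -
  have lin: "\<alpha> r (x + y) = \<alpha> r x + \<alpha> r y" "\<alpha> r (c *\<^sub>C x) = c *\<^sub>C \<alpha> r x" for x y c
    using flow_linear[of r] by (simp_all add: clinear_op_def)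
  note H = csubspace_hull[of generators, unfolded csubspace_def[of A]]
  have zero: "\<alpha> r 0 = 0" using lin(2)[of 0 0] by simp
  have "A \<subseteq> {a. \<alpha> r a \<in> A}"
  proof (rule hull_minimal)
    show "csubspace {a. \<alpha> r a \<in> A}"
      using H unfolding csubspace_def[of "{a. \<alpha> r a \<in> A}"] by (simp add: lin zero)
    have "\<alpha> r (W t * star (W u)) \<in> A"
      if "t \<in> lists Y" "u \<in> lists Y" "word_eval G t = word_eval G u" for t u
      unfolding flow_generator[OF that(1,2)] using H generator_in_A[OF that] by blast
    then show "generators \<subseteq> {a. \<alpha> r a \<in> A}" by blast
  qed
  then show ?thesis by blast
qed

section \<open>The KMS condition in terms of cylinder weights\<close>

context
  fixes m assumes m: "borel_prob_on_paths Y m"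
begin

text \<open>The product is 0 or a single \<open>W p * star (W q)\<close>, which contributes only for
  \<open>p = q\<close>; the two branches record which inner word is longer. If both conditions hold,
  then \<open>y\<close> is empty and \<open>r = t\<close>, so the values agree.\<close>

lemma measure_functional_product:
  assumes t: "t \<in> lists Y" and u: "u \<in> lists Y" and s: "s \<in> lists Y" and r: "r \<in> lists Y"
  shows "measure_functional m (W t * star (W u) * (W s * star (W r))) =
    (if \<exists>y. s = u @ y \<and> r = t @ y then complex_of_real (measure m (cylinder Y r))
     else if \<exists>y. u = s @ y \<and> t = r @ y then complex_of_real (measure m (cylinder Y t))
     else 0)"
  using u s
proof (cases rule: cylinder_append_disjoint_cases)
  case (left y)
  have "W t * star (W u) * (W s * star (W r)) = W t * (star (W u) * W u) * W y * star (W r)"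
    by (simp add: left W_append mult.assoc)
  also have "\<dots> = W (t @ y) * star (W r)" by (simp add: star_W_W u W_append)
  finally show ?thesis using left t r by (auto simp: measure_functional_W_star_W[OF m])
next
  case (right y)
  have "W t * star (W u) * (W s * star (W r)) = W t * star (W y) * (star (W s) * W s) * star (W r)"
    by (simp add: right W_append star_mult mult.assoc)
  also have "\<dots> = W t * star (W (r @ y))" by (simp add: star_W_W s W_append star_mult mult.assoc)
  finally show ?thesis using right t r by (auto simp: measure_functional_W_star_W[OF m])
next
  case disjoint
  have "W t * star (W u) * (W s * star (W r)) = W t * (star (W u) * W s) * star (W r)"
    by (simp add: mult.assoc)
  then have "W t * star (W u) * (W s * star (W r)) = 0"
    by (simp add: star_W_W_disjoint[OF u s disjoint])
  moreover have "s \<noteq> u @ y" "u \<noteq> s @ y" for y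
    using disjoint cylinder_append_subset[of Y u y] cylinder_append_subset[of Y s y]
      cylinder_nonempty[OF Y_nonempty u] cylinder_nonempty[OF Y_nonempty s] by auto
  moreover have "measure_functional m 0 = 0"
    using measure_functional_scaleC[OF m, of 0 0] by simp
  ultimately show ?thesis by simp
qed

text \<open>Interchanging the factors interchanges the two nonzero branches. In each of them the
  weights of the two cylinders differ by the weights of \<open>t\<close> and \<open>u\<close>, since
  a common tail or the pair \<open>s\<close>, \<open>r\<close> cancels.\<close>

lemma KMS_generators:
  assumes weight: "\<And>t. t \<in> lists Y \<Longrightarrow> measure m (cylinder Y t) = exp (- \<beta> * word_weight F t)"
    and t: "t \<in> lists Y" and u: "u \<in> lists Y" and s: "s \<in> lists Y" and r: "r \<in> lists Y"
  shows "measure_functional m (W t * star (W u) * (W s * star (W r))) =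
    complex_of_real (exp (- \<beta> * (word_weight F t - word_weight F u))) *
    measure_functional m (W s * star (W r) * (W t * star (W u)))"
proof -
  consider (1) y where "s = u @ y" "r = t @ y" | (2) y where "u = s @ y" "t = r @ y"
    | (3) "\<nexists>y. s = u @ y \<and> r = t @ y" "\<nexists>y. u = s @ y \<and> t = r @ y" by blast
  then show ?thesis
  proof cases
    case (1 y)
    then have "measure_functional m (W t * star (W u) * (W s * star (W r))) = measure m (cylinder Y r)"
      and "measure_functional m (W s * star (W r) * (W t * star (W u))) = measure m (cylinder Y s)"
      using measure_functional_product[OF t u s r] measure_functional_product[OF s r t u] by auto
    then show ?thesis using s r
      by (simp add: weight 1 word_weight_append algebra_simps flip: exp_add of_real_mult)
  next
    case (2 y)
    then have "measure_functional m (W t * star (W u) * (W s * star (W r))) = measure m (cylinder Y t)"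
      and "measure_functional m (W s * star (W r) * (W t * star (W u))) = measure m (cylinder Y u)"
      using measure_functional_product[OF t u s r] measure_functional_product[OF s r t u] by auto
    then show ?thesis using t u
      by (simp add: weight algebra_simps flip: exp_add of_real_mult)
  next
    case 3
    then show ?thesis
      using measure_functional_product[OF t u s r] measure_functional_product[OF s r t u] by auto
  qed
qed

lemma KMS_state_measure_functional:
  assumes weight: "\<And>t. t \<in> lists Y \<Longrightarrow> measure m (cylinder Y t) = exp (- \<beta> * word_weight F t)"
  shows "KMS_state B \<alpha> \<beta> (measure_functional m)"
proof -
  let ?w = "measure_functional m"
  note H = csubspace_hull[of generators, unfolded csubspace_def[of A]]
  note add = measure_functional_add[OF m] and scale = measure_functional_scaleC[OF m]
  have zero: "?w 0 = 0" using scale[of 0 0] by simp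
  \<comment> \<open>For fixed \<open>A\<close> the existence of such an extension is a linear
    condition on \<open>a\<close>, so it suffices to check generators. Requiring values in
    \<open>A\<close> makes the closure properties purely algebraic.\<close>
  define S where "S = {a. \<exists>f. entire f \<and> range f \<subseteq> A \<and> (\<forall>r. f (complex_of_real r) = \<alpha> r a) \<and>
      (\<forall>b\<in>A. ?w (a * b) = ?w (b * f (\<i> * complex_of_real \<beta>)))}"
  have lin: "\<alpha> r (x + y) = \<alpha> r x + \<alpha> r y" "\<alpha> r (c *\<^sub>C x) = c *\<^sub>C \<alpha> r x" for r x y c
    using flow_linear[of r] by (simp_all add: clinear_op_def)
  have S_scale: "c *\<^sub>C a \<in> S" if "a \<in> S" for a c
  proof -
    obtain f where "entire f" "range f \<subseteq> A" "\<And>r. f (complex_of_real r) = \<alpha> r a"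
      "\<And>b. b \<in> A \<Longrightarrow> ?w (a * b) = ?w (b * f (\<i> * complex_of_real \<beta>))"
      using \<open>a \<in> S\<close> unfolding S_def by blast
    then show ?thesis
      unfolding S_def mem_Collect_eq using H
      by (intro exI[of _ "\<lambda>z. c *\<^sub>C f z"])
         (auto simp: entire_scaleC lin scale scaleC_mult_left scaleC_mult_right image_subset_iff)
  qed
  have S_gen: "W t * star (W u) \<in> S"
    if t: "t \<in> lists Y" and u: "u \<in> lists Y" and tu: "word_eval G t = word_eval G u" for t u
  proof -
    let ?a = "W t * star (W u)"
    let ?l = "word_weight F t - word_weight F u"
    \<comment> \<open>The phase by which the flow multiplies \<open>?a\<close>, continued to complex
      time; at \<open>\<i> * \<beta>\<close> it becomes the real factor
      \<open>exp (- \<beta> * ?l)\<close>.\<close>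
    define f where "f z = exp (\<i> * z * complex_of_real ?l) *\<^sub>C ?a" for z
    have a: "?a \<in> A" by (rule generator_in_A[OF t u tu])
    have "entire f"
      unfolding f_def[abs_def] by (intro entire_scaleC_left holomorphic_intros)
    moreover have "range f \<subseteq> A" using H a by (auto simp: f_def)
    moreover have "f (complex_of_real r) = \<alpha> r ?a" for r
      using t u by (simp add: f_def flow_generator mult.assoc)
    moreover have "?w (?a * b) = ?w (b * f (\<i> * complex_of_real \<beta>))" if b: "b \<in> A" for b
    proof -
      let ?c = "complex_of_real (exp (- \<beta> * ?l))"
      have c: "f (\<i> * complex_of_real \<beta>) = ?c *\<^sub>C ?a"
        by (simp add: f_def exp_of_real[symmetric] flip: mult.assoc)
      have "A \<subseteq> {b. ?w (?a * b) = ?c * ?w (b * ?a)}"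
      proof (rule hull_minimal)
        show "csubspace {b. ?w (?a * b) = ?c * ?w (b * ?a)}"
          by (auto simp: csubspace_def zero add scale distrib_left distrib_right
              scaleC_mult_left scaleC_mult_right)
        show "generators \<subseteq> {b. ?w (?a * b) = ?c * ?w (b * ?a)}"
          using KMS_generators[OF weight t u] by blast
      qed
      then show ?thesis using b by (auto simp: c scale scaleC_mult_right)
    qed
    ultimately show ?thesis unfolding S_def by blast
  qed
  have "A \<subseteq> S"
  proof (rule hull_minimal)
    have "csubspace S"
      unfolding csubspace_def[of S]
    proof (intro conjI ballI allI S_scale)
      have "0 *\<^sub>C (W [] * star (W [])) \<in> S" by (intro S_scale S_gen) auto
      then show "0 \<in> S" by simp
    next
      fix a a' assume a: "a \<in> S" and a': "a' \<in> S"
      obtain f where f: "entire f" "range f \<subseteq> A" "\<And>r. f (complex_of_real r) = \<alpha> r a"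
          "\<And>b. b \<in> A \<Longrightarrow> ?w (a * b) = ?w (b * f (\<i> * complex_of_real \<beta>))"
        using a unfolding S_def by blast
      obtain f' where f': "entire f'" "range f' \<subseteq> A" "\<And>r. f' (complex_of_real r) = \<alpha> r a'"
          "\<And>b. b \<in> A \<Longrightarrow> ?w (a' * b) = ?w (b * f' (\<i> * complex_of_real \<beta>))"
        using a' unfolding S_def by blast
      have "entire (\<lambda>z. f z + f' z)" by (rule entire_add[OF f(1) f'(1)])
      moreover have "range (\<lambda>z. f z + f' z) \<subseteq> A"
        using H f(2) f'(2) by (auto simp: image_subset_iff)
      ultimately show "a + a' \<in> S"
        unfolding S_def mem_Collect_eq using f(3,4) f'(3,4)
        by (intro exI[of _ "\<lambda>z. f z + f' z"]) (simp add: lin add distrib_left distrib_right)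
    qed
    then show "csubspace S" .
    show "generators \<subseteq> S" using S_gen by blast
  qed
  moreover have "\<exists>f. analytic_extension B \<alpha> a f \<and> (\<forall>b\<in>A. ?w (a * b) = ?w (b * f (\<i> * complex_of_real \<beta>)))"
    if "a \<in> S" for a
  proof -
    obtain f where "entire f" "range f \<subseteq> A" "\<forall>r. f (complex_of_real r) = \<alpha> r a"
      "\<forall>b\<in>A. ?w (a * b) = ?w (b * f (\<i> * complex_of_real \<beta>))"
      using \<open>a \<in> S\<close> unfolding S_def by blast
    then show ?thesis using A_subset_B unfolding analytic_extension_def by (intro exI[of _ f]) blast
  qed
  ultimately have "\<forall>a\<in>A. \<exists>f. analytic_extension B \<alpha> a f \<and>
      (\<forall>b\<in>A. ?w (a * b) = ?w (b * f (\<i> * complex_of_real \<beta>)))" by blast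
  then show ?thesis
    unfolding KMS_state_def
    using state_on_measure_functional[OF m B_subset] star_subalgebra_A A_subset_B flow_invariant_A B_eq
    by (intro conjI exI[of _ A] allI) simp_all
qed

text \<open>The eigenvector \<open>W t * star (W u)\<close> is paired with its adjoint: the two
  products are the projections of the cylinders of \<open>t\<close> and \<open>u\<close>. Equality
  of the group values places both elements in \<open>B\<close>.\<close>

lemma KMS_state_cylinder_weight:
  assumes KMS: "KMS_state B \<alpha> \<beta> (measure_functional m)"
    and t: "t \<in> lists Y" and u: "u \<in> lists Y" and tu: "word_eval G t = word_eval G u"
  shows "measure m (cylinder Y t) * exp (\<beta> * word_weight F t) =
    measure m (cylinder Y u) * exp (\<beta> * word_weight F u)"
proof -
  let ?a = "W t * star (W u)" and ?b = "W u * star (W t)"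
  let ?l = "word_weight F t - word_weight F u"
  have "?a \<in> B" "?b \<in> B"
    using generator_in_A[OF t u tu] generator_in_A[OF u t tu[symmetric]] A_subset_B by auto
  then have "measure_functional m (?b * ?a) = complex_of_real (exp (\<beta> * ?l)) * measure_functional m (?a * ?b)"
    by (intro KMS_state_eigenvector[OF one_parameter_group_flow KMS] flow_generator[OF t u]
        measure_functional_add[OF m] measure_functional_scaleC[OF m] measure_functional_bound[OF m])
  moreover have "?b * ?a = W u * (star (W t) * W t) * star (W u)"
    "?a * ?b = W t * (star (W u) * W u) * star (W t)" by (simp_all add: mult.assoc)
  ultimately have "complex_of_real (measure m (cylinder Y u)) =
      complex_of_real (exp (\<beta> * ?l) * measure m (cylinder Y t))"
    using t u by (simp add: star_W_W measure_functional_W_star_W[OF m])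
  then have "measure m (cylinder Y u) = exp (\<beta> * ?l) * measure m (cylinder Y t)"
    by (simp only: of_real_eq_iff)
  then show ?thesis by (simp add: right_diff_distrib exp_diff)
qed

lemma abelian_KMS_state_weights:
  assumes gen: "generates_as_semigroup G Y"
    and fin: "finite (carrier (G Mod derived G (carrier G)))"
    and abelian: "abelian_measure Y m" and KMS: "KMS_state B \<alpha> \<beta> (measure_functional m)"
  shows "(\<Sum>s\<in>Y. exp (- \<beta> * F s)) = 1"
    and "t \<in> lists Y \<Longrightarrow> measure m (cylinder Y t) = exp (- \<beta> * word_weight F t)"
proof -
  interpret prob_space m using m by (simp add: borel_prob_on_paths_def)
  \<comment> \<open>Any choice of representatives will do: \<open>KMS_state_cylinder_weight\<close>
    makes the resulting value independent of it.\<close>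
  define word where "word g = (SOME t. t \<in> lists Y \<and> word_eval G t = g)" for g
  define \<nu> where "\<nu> g = measure m (cylinder Y (word g)) * exp (\<beta> * word_weight F (word g))" for g
  have \<nu>: "\<nu> (word_eval G t) = measure m (cylinder Y t) * exp (\<beta> * word_weight F t)"
    if t: "t \<in> lists Y" for t
  proof -
    have "word (word_eval G t) \<in> lists Y \<and> word_eval G (word (word_eval G t)) = word_eval G t"
      unfolding word_def by (rule someI[of _ t]) (use t in simp)
    then show ?thesis unfolding \<nu>_def by (intro KMS_state_cylinder_weight[OF KMS] t) auto
  qed
  have surj: "\<exists>t\<in>lists Y. g = word_eval G t" if "g \<in> carrier G" for g
    using gen that unfolding generates_as_semigroup_def by blast
  have comm: "\<nu> (x \<otimes> y \<otimes> z) = \<nu> (x \<otimes> z \<otimes> y)"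
    if x: "x \<in> carrier G" and y: "y \<in> carrier G" and z: "z \<in> carrier G" for x y z
  proof -
    obtain a b c where abc: "a \<in> lists Y" "b \<in> lists Y" "c \<in> lists Y"
      "x = word_eval G a" "y = word_eval G b" "z = word_eval G c"
      using surj[OF x] surj[OF y] surj[OF z] by blast
    have "x \<otimes> y \<otimes> z = word_eval G (a @ b @ c)" "x \<otimes> z \<otimes> y = word_eval G (a @ c @ b)"
      using abc x y z by (simp_all add: word_eval_append[OF Y_subset] m_assoc)
    moreover have "measure m (cylinder Y (a @ b @ c)) = measure m (cylinder Y (a @ c @ b))"
      using abelian abc unfolding abelian_measure_def measure_def by metis
    ultimately show ?thesis using abc by (simp add: \<nu> word_weight_append add_ac)
  qed
  \<comment> \<open>The factor \<open>exp (- \<beta> * F s)\<close> cancels the weight of the last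
    letter, and the cylinders of \<open>t @ [s]\<close> partition that of \<open>t\<close>.\<close>
  have harmonic: "\<nu> g = (\<Sum>s\<in>Y. exp (- \<beta> * F s) * \<nu> (g \<otimes> s))" if g: "g \<in> carrier G" for g
  proof -
    obtain t where t: "t \<in> lists Y" "g = word_eval G t" using surj[OF g] by blast
    have "\<nu> (g \<otimes> s) = measure m (cylinder Y (t @ [s])) * exp (\<beta> * word_weight F (t @ [s]))" if s: "s \<in> Y" for s
    proof -
      have "word_eval G [s] = s" using s Y_subset by (auto simp: word_eval_def)
      then have "g \<otimes> s = word_eval G (t @ [s])"
        using s t word_eval_append[OF Y_subset t(1), of "[s]"] by simp
      then show ?thesis using \<nu>[of "t @ [s]"] s t by simp
    qed
    then have "(\<Sum>s\<in>Y. exp (- \<beta> * F s) * \<nu> (g \<otimes> s)) =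
        (\<Sum>s\<in>Y. measure m (cylinder Y (t @ [s])) * exp (\<beta> * word_weight F t))"
      by (intro sum.cong refl) (simp add: word_weight_def exp_minus field_simps exp_add)
    also have "\<dots> = (\<Sum>s\<in>Y. measure m (cylinder Y (t @ [s]))) * exp (\<beta> * word_weight F t)"
      by (simp add: sum_distrib_right)
    also have "(\<Sum>s\<in>Y. measure m (cylinder Y (t @ [s]))) = measure m (\<Union>s\<in>Y. cylinder Y (t @ [s]))"
    proof (rule finite_measure_finite_Union[OF finite_Y, symmetric])
      show "(\<lambda>s. cylinder Y (t @ [s])) ` Y \<subseteq> sets m"
        using t by (auto intro!: cylinder_in_sets[OF m])
      show "disjoint_family_on (\<lambda>s. cylinder Y (t @ [s])) Y"
      proof -
        have "x (length t) = s" if "x \<in> cylinder Y (t @ [s])" for x s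
          using that by (simp add: cylinder_def)
        then show ?thesis unfolding disjoint_family_on_def by blast
      qed
    qed
    also have "(\<Union>s\<in>Y. cylinder Y (t @ [s])) = cylinder Y t"
      by (rule cylinder_eq_UN_children[OF t(1), symmetric])
    finally show ?thesis by (simp add: \<nu> t)
  qed
  \<comment> \<open>The empty word represents \<one>, and its cylinder is the whole space.\<close>
  have one: "\<nu> \<one> = 1"
  proof -
    have "measure m (cylinder Y []) = 1"
      using prob_space space_borel_prob_on_paths[OF m] by (simp add: cylinder_Nil)
    then show ?thesis using \<nu>[of "[]"] by (simp add: word_eval_def word_weight_def)
  qed
  note potential = harmonic_finite_range_constant[OF Y_subset finite_Y gen _ harmonic _ one
      finite_range_if_commuting[of \<nu>, OF comm fin]]
  show "(\<Sum>s\<in>Y. exp (- \<beta> * F s)) = 1" by (rule potential(1)) (auto simp: \<nu>_def)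
  show "measure m (cylinder Y t) = exp (- \<beta> * word_weight F t)" if t: "t \<in> lists Y"
  proof -
    have "\<nu> (word_eval G t) = 1"
      by (rule potential(2)) (auto simp: \<nu>_def word_eval_closed[OF Y_subset t])
    then show ?thesis using t by (simp add: \<nu> exp_minus field_simps)
  qed
qed

end

end

lemma prod_list_exp_weight:
  "prod_list (map (\<lambda>s. exp (- \<beta> * F s)) t) = exp (- \<beta> * word_weight F t)"
  by (induction t) (simp_all add: word_weight_def right_diff_distrib distrib_left flip: exp_add)

theorem proposition4p6:
  fixes G :: "('g, 'm) monoid_scheme"
    and Y :: "'g set"
    and F :: "'g \<Rightarrow> real"
    and \<beta> :: real
    and V :: "'g \<Rightarrow> 'a::cstar_algebra"
    and \<alpha> :: "real \<Rightarrow> 'a \<Rightarrow> 'a"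
    and E :: "'a \<Rightarrow> 'a"
    and \<Gamma> :: "'a \<Rightarrow> (nat \<Rightarrow> 'g) \<Rightarrow> complex"
  assumes "group G"
    and "Y \<subseteq> carrier G" and "finite Y" and "2 \<le> card Y"
    and "generates_as_semigroup G Y"
    and "cuntz_algebra Y V"
    and "gauge_flow Y V F \<alpha>"
    and "diagonal_iso Y V \<Gamma>"
    and "diagonal_expectation Y V E"
    and "finite (carrier (G Mod (derived G (carrier G))))"
  shows "((\<exists>m. abelian_measure Y m \<and> KMS_measure G Y V \<alpha> E \<Gamma> \<beta> m) \<longleftrightarrow>
            (\<Sum>s\<in>Y. exp (- \<beta> * F s)) = 1) \<and>
         (\<forall>m. abelian_measure Y m \<and> KMS_measure G Y V \<alpha> E \<Gamma> \<beta> m \<longrightarrow>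
            m = bernoulli_measure Y (\<lambda>s. exp (- \<beta> * F s)))"
proof -
  have "Y \<noteq> {}" using assms(4) by auto
  interpret group G by fact
  interpret cuntz_flow Y V \<Gamma> E G F \<alpha>
    by unfold_locales (use assms \<open>Y \<noteq> {}\<close> in auto)
  let ?p = "\<lambda>s. exp (- \<beta> * F s)"
  let ?b = "bernoulli_measure Y ?p"
  have KMS_iff: "KMS_measure G Y V \<alpha> E \<Gamma> \<beta> m \<longleftrightarrow>
      borel_prob_on_paths Y m \<and> KMS_state B \<alpha> \<beta> (measure_functional m)" for m
    by (simp add: KMS_measure_def measure_functional_def[abs_def] point_functional_def)
  have bernoulli: "borel_prob_on_paths Y ?b"
    and cyl: "\<And>t. t \<in> lists Y \<Longrightarrow> emeasure ?b (cylinder Y t) = ennreal (exp (- \<beta> * word_weight F t))"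
    if "sum ?p Y = 1"
    using borel_prob_bernoulli[OF assms(3), of ?p] emeasure_bernoulli_cylinder[OF assms(3), of ?p] that
    by (simp_all only: prod_list_exp_weight exp_ge_zero)
  have "abelian_measure Y ?b \<and> KMS_measure G Y V \<alpha> E \<Gamma> \<beta> ?b" if "sum ?p Y = 1"
  proof
    show "abelian_measure Y ?b"
      unfolding abelian_measure_def
    proof (intro ballI)
      fix t1 t2 t3 assume "t1 \<in> lists Y" "t2 \<in> lists Y" "t3 \<in> lists Y"
      then show "emeasure ?b (cylinder Y (t1 @ t2 @ t3)) = emeasure ?b (cylinder Y (t1 @ t3 @ t2))"
        using cyl[OF that, of "t1 @ t2 @ t3"] cyl[OF that, of "t1 @ t3 @ t2"]
        by (simp add: word_weight_append add_ac)
    qed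
    have "measure ?b (cylinder Y t) = exp (- \<beta> * word_weight F t)" if "t \<in> lists Y" for t
      using cyl[OF \<open>sum ?p Y = 1\<close> that] by (simp add: measure_def)
    then show "KMS_measure G Y V \<alpha> E \<Gamma> \<beta> ?b"
      using KMS_state_measure_functional bernoulli[OF that] unfolding KMS_iff by blast
  qed
  \<comment> \<open>One statement yields both the necessity of the sum condition and
    uniqueness.\<close>
  moreover have "sum ?p Y = 1 \<and> m = ?b" if "abelian_measure Y m" "KMS_measure G Y V \<alpha> E \<Gamma> \<beta> m" for m
  proof
    have m: "borel_prob_on_paths Y m" and KMS: "KMS_state B \<alpha> \<beta> (measure_functional m)"
      using that(2) KMS_iff by auto
    interpret prob_space m using m by (simp add: borel_prob_on_paths_def)
    note weights = abelian_KMS_state_weights[OF m assms(5,10) that(1) KMS]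
    show sum: "sum ?p Y = 1" by (rule weights(1))
    show "m = ?b"
      by (rule borel_prob_on_paths_eqI[OF assms(3) m bernoulli[OF sum]])
         (simp only: emeasure_eq_measure weights(2) cyl[OF sum])
  qed
  ultimately show ?thesis by blast
qed

end
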